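(* Let $r\ge1$, let $n=2r$ or $n=2r+1$, let $e\in\{1,-1\}$ and $N=[\frac{n+1}{2}]$. Let $\mathbf A_q$ be the modified $q$-Weyl algebra acting on $\mathbb P=\mathbb Q(q)[X_1,\dots,X_{r+1}]$, and let $(T_i,\mathcal T_i)_{1\le i\le N}$ be either $(T'_{i,e},\mathcal T'_{i,e})_{1\le i\le N}$ or $(T''_{i,-e},\mathcal T''_{i,-e})_{1\le i\le N}$. Then for any $\mathfrak k\in\mathbf A_q$, $f\in\mathbb P$ and $1\le i\le N$, $$\mathcal T_i(\mathfrak k f)=T_i(\mathfrak k)\,\mathcal T_i(f).$$ Moreover, the following braid relations hold: $$\mathcal T_{i-1}\mathcal T_i\mathcal T_{i-1}=\mathcal T_i\mathcal T_{i-1}\mathcal T_i\quad\text{if }2\le i\le N-1,$$ $$\mathcal T_{i-1}\mathcal T_i\mathcal T_{i-1}\mathcal T_i=\mathcal T_i\mathcal T_{i-1}\mathcal T_i\mathcal T_{i-1}\quad\text{if }i=N,$$ $$\mathcal T_i\mathcal T_j=\mathcal T_j\mathcal T_i\quad\text{if }|i-j|\ne1,$$ for all indices for which the operators involved are defined.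
   Context: Fix $r\ge1$, $n=2r$ or $n=2r+1$, so $N=r$ if $n=2r$ and $N=r+1$ if $n=2r+1$. Put $c_i=1$ for $i\le r$, $c_{r+1}=2$ if $n=2r$, $c_{r+1}=1$ if $n=2r+1$. The modified $q$-Weyl algebra $\mathbf A_q$ ($\mathbf A_q^\jmath$ if $n=2r$, $\mathbf A_q^\imath$ if $n=2r+1$) is the $\mathbb Q(q)$-algebra generated by $\mathfrak d_i,\mathfrak x_i,\mathfrak m_i^{\pm1}$ ($1\le i\le r+1$) with relations: $\mathfrak m_i\mathfrak m_i^{-1}=\mathfrak m_i^{-1}\mathfrak m_i=1$; all $\mathfrak m$'s commute, all $\mathfrak d$'s commute, all $\mathfrak x$'s commute; for $i\ne j$, $\mathfrak d_i\mathfrak m_j=\mathfrak m_j\mathfrak d_i$, $\mathfrak x_i\mathfrak m_j=\mathfrak m_j\mathfrak x_i$, $\mathfrak d_i\mathfrak x_j=\mathfrak x_j\mathfrak d_i$; $\mathfrak d_i\mathfrak m_i=q^{c_i}\mathfrak m_i\mathfrak d_i$, $\mathfrak x_i\mathfrak m_i=q^{-c_i}\mathfrak m_i\mathfrak x_i$; $\mathfrak d_i\mathfrak x_i=\frac{q^{c_i}\mathfrak m_i-q^{-c_i}\mathfrak m_i^{-1}}{q-q^{-1}}$, $\mathfrak x_i\mathfrak d_i=\frac{\mathfrak m_i-\mathfrak m_i^{-1}}{q-q^{-1}}$. The automorphisms $T'_{i,e},T''_{i,-e}$ of $\mathbf A_q$ ($1\le i\le N$; $\mathbb Q(q)$-algebra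 automorphisms; generators not listed are fixed). For $i\le N-1$: both interchange $\mathfrak m_i$ and $\mathfrak m_{i+1}$; $T'_{i,e}(\mathfrak d_{i+1})=-q^{-e}\mathfrak m_{i+1}^{-e}\mathfrak d_i$, $T'_{i,e}(\mathfrak d_i)=\mathfrak m_i^{-e}\mathfrak d_{i+1}$, $T'_{i,e}(\mathfrak x_{i+1})=-q^{e}\mathfrak m_{i+1}^{e}\mathfrak x_i$, $T'_{i,e}(\mathfrak x_i)=\mathfrak m_i^{e}\mathfrak x_{i+1}$; $T''_{i,-e}(\mathfrak d_{i+1})=\mathfrak m_{i+1}^{e}\mathfrak d_i$, $T''_{i,-e}(\mathfrak d_i)=-q^{e}\mathfrak m_i^{e}\mathfrak d_{i+1}$, $T''_{i,-e}(\mathfrak x_{i+1})=\mathfrak m_{i+1}^{-e}\mathfrak x_i$, $T''_{i,-e}(\mathfrak x_i)=-q^{-e}\mathfrak m_i^{-e}\mathfrak x_{i+1}$. For $n=2r$, $i=r$: $T'_{r,e}(\mathfrak d_{r+1})=q^{e}\mathfrak m_r^{-2e}\mathfrak d_{r+1}$, $T'_{r,e}(\mathfrak d_r)=q^{-2e}\mathfrak m_r^{-e}\mathfrak m_{r+1}^{-e}\mathfrak d_r$, $T'_{r,e}(\mathfrak x_{r+1})=q^{-e}\mathfrak m_r^{2e}\mathfrak x_{r+1}$, $T'_{r,e}(\mathfrak x_r)=q^{e}\mathfrak m_r^{e}\mathfrak m_{r+1}^{e}\mathfrak x_r$; $T''_{r,-e}(\mathfrak d_{r+1})=q^{-e}\mathfrak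 m_r^{2e}\mathfrak d_{r+1}$, $T''_{r,-e}(\mathfrak d_r)=q^{2e}\mathfrak m_r^{e}\mathfrak m_{r+1}^{e}\mathfrak d_r$, $T''_{r,-e}(\mathfrak x_{r+1})=q^{e}\mathfrak m_r^{-2e}\mathfrak x_{r+1}$, $T''_{r,-e}(\mathfrak x_r)=q^{-e}\mathfrak m_r^{-e}\mathfrak m_{r+1}^{-e}\mathfrak x_r$. For $n=2r+1$, $i=r+1$: $T'_{r+1,e}(\mathfrak d_{r+1})=\mathfrak m_{r+1}^{-e}\mathfrak d_{r+1}$, $T'_{r+1,e}(\mathfrak x_{r+1})=q^{-e}\mathfrak m_{r+1}^{e}\mathfrak x_{r+1}$; $T''_{r+1,-e}(\mathfrak d_{r+1})=\mathfrak m_{r+1}^{e}\mathfrak d_{r+1}$, $T''_{r+1,-e}(\mathfrak x_{r+1})=q^{e}\mathfrak m_{r+1}^{-e}\mathfrak x_{r+1}$. Action of $\mathbf A_q$ on $\mathbb P=\mathbb Q(q)[X_1,\dots,X_{r+1}]$: for $\mathbf a=(a_1,\dots,a_{r+1})\in\mathbb Z_{\ge0}^{r+1}$ and $\mathbf X^{\mathbf a}=X_1^{a_1}\cdots X_{r+1}^{a_{r+1}}$, with $[k]=\frac{q^k-q^{-k}}{q-q^{-1}}$ and $\mathbf e_i$ the $i$-th standard unit tuple, $\mathfrak d_i\mathbf X^{\mathbf a}=[c_ia_i]\mathbf X^{\mathbf a-\mathbf e_i}$ (zero if $a_i=0$), $\mathfrak x_i\mathbf X^{\mathbf a}=\mathbf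 X^{\mathbf a+\mathbf e_i}$, $\mathfrak m_i\mathbf X^{\mathbf a}=q^{c_ia_i}\mathbf X^{\mathbf a}$. The $\mathbb Q(q)$-linear operators $\mathcal T'_{i,e},\mathcal T''_{i,-e}$ on $\mathbb P$ ($1\le i\le N$), where $s_i$ switches $X_i$ and $X_{i+1}$ in $\mathbf X^{\mathbf a}$: for $i\le N-1$, $\mathcal T'_{i,e}(\mathbf X^{\mathbf a})=(-q^{-e})^{-a_{i+1}}q^{ea_ia_{i+1}}(s_i\mathbf X^{\mathbf a})$ and $\mathcal T''_{i,-e}(\mathbf X^{\mathbf a})=(-q^{-e})^{a_i}q^{-ea_ia_{i+1}}(s_i\mathbf X^{\mathbf a})$; for $n=2r$, $i=r$, $\mathcal T'_{r,e}(\mathbf X^{\mathbf a})=q^{\frac12ea_r^2+\frac32ea_r-ea_{r+1}+2ea_ra_{r+1}}\mathbf X^{\mathbf a}$ and $\mathcal T''_{r,-e}(\mathbf X^{\mathbf a})=q^{-\frac12ea_r^2-\frac32ea_r+ea_{r+1}-2ea_ra_{r+1}}\mathbf X^{\mathbf a}$; for $n=2r+1$, $i=r+1$, $\mathcal T'_{r+1,e}(\mathbf X^{\mathbf a})=q^{\frac12ea_{r+1}^2-\frac12ea_{r+1}}\mathbf X^{\mathbf a}$ and $\mathcal T''_{r+1,-e}(\mathbf X^{\mathbf a})=q^{-\frac12ea_{r+1}^2+\frac12ea_{r+1}}\mathbf X^{\mathbf a}$. *)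

theory Defs
  imports
    "HOL-Computational_Algebra.Computational_Algebra"
    "HOL-Library.Poly_Mapping"
    "HOL-Combinatorics.Transposition"
    "HOL-Algebra.QuotRing"
begin

section \<open>The base field and multivariate polynomials\<close>

type_synonym Qq = "rat poly fract"

definition q :: Qq where
  "q = Fract [:0, 1:] 1"

definition qint :: "int \<Rightarrow> Qq" where
  "qint k = (q powi k - q powi (- k)) / (q - inverse q)"

text \<open>A polynomial is a finitely supported function on exponent vectors; \<open>polys r\<close> is
  \<open>\<rat>(q)[X\<^sub>1, \<dots>, X\<^sub>r\<^sub>+\<^sub>1]\<close>.\<close>

type_synonym expo = "nat \<Rightarrow>\<^sub>0 nat"
type_synonym pols = "expo \<Rightarrow>\<^sub>0 Qq"

definition polys :: "nat \<Rightarrow> pols set" where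
  "polys r = {f. \<forall>a \<in> Poly_Mapping.keys f. Poly_Mapping.keys a \<subseteq> {1..r + 1}}"

text \<open>\<open>scal c\<close> is the constant \<open>c\<close> in a monoid algebra over \<open>\<rat>(q)\<close>; \<open>lin_ext \<phi>\<close> is the
  \<open>\<rat>(q)\<close>-linear map sending the basis element \<open>w\<close> to \<open>\<phi> w\<close>. Both are used for polynomials
  and for the free algebra below.\<close>

definition scal :: "Qq \<Rightarrow> ('b::monoid_add \<Rightarrow>\<^sub>0 Qq)" where
  "scal c = Poly_Mapping.single 0 c"

definition lin_ext :: "('a \<Rightarrow> ('b::monoid_add \<Rightarrow>\<^sub>0 Qq)) \<Rightarrow> ('a \<Rightarrow>\<^sub>0 Qq) \<Rightarrow> ('b \<Rightarrow>\<^sub>0 Qq)" where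
  "lin_ext \<phi> f = (\<Sum>w \<in> Poly_Mapping.keys f. scal (Poly_Mapping.lookup f w) * \<phi> w)"

section \<open>The free algebra\<close>

text \<open>The free monoid is written additively, because multiplication of finitely supported
  functions is convolution with respect to \<open>+\<close> on the keys.\<close>

datatype 'g free_monoid = Wd (letters: "'g list")

instantiation free_monoid :: (type) monoid_add
begin

definition zero_free_monoid :: "'a free_monoid" where
  "0 = Wd []"

definition plus_free_monoid :: "'a free_monoid \<Rightarrow> 'a free_monoid \<Rightarrow> 'a free_monoid" where
  "u + v = Wd (letters u @ letters v)"

instance
  by standard (simp_all add: zero_free_monoid_def plus_free_monoid_def)

end

datatype gen = D nat | X nat | M nat | Minv nat

type_synonym falg = "gen free_monoid \<Rightarrow>\<^sub>0 Qq"

definition gen_el :: "gen \<Rightarrow> falg" where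
  "gen_el g = Poly_Mapping.single (Wd [g]) 1"

abbreviation dd :: "nat \<Rightarrow> falg" where "dd i \<equiv> gen_el (D i)"
abbreviation xx :: "nat \<Rightarrow> falg" where "xx i \<equiv> gen_el (X i)"
abbreviation mm :: "nat \<Rightarrow> falg" where "mm i \<equiv> gen_el (M i)"
abbreviation mi :: "nat \<Rightarrow> falg" where "mi i \<equiv> gen_el (Minv i)"

definition mpow :: "nat \<Rightarrow> int \<Rightarrow> falg" where
  "mpow i k = (if k \<ge> 0 then mm i ^ nat k else mi i ^ nat (- k))"

definition gens :: "nat \<Rightarrow> gen set" where
  "gens r = (\<Union>i \<in> {1..r + 1}. {D i, X i, M i, Minv i})"

definition free_alg :: "nat \<Rightarrow> falg ring" where
  "free_alg r =
    \<lparr>carrier = {p. \<forall>w \<in> Poly_Mapping.keys p. set (letters w) \<subseteq> gens r},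
     mult = (*), one = 1, zero = 0, add = (+)\<rparr>"

definition alg_hom :: "(gen \<Rightarrow> falg) \<Rightarrow> falg \<Rightarrow> falg" where
  "alg_hom \<phi> = lin_ext (\<lambda>w. prod_list (map \<phi> (letters w)))"

section \<open>The modified \<open>q\<close>-Weyl algebra\<close>

text \<open>Throughout, \<open>n\<close> is \<open>2 * r\<close> or \<open>2 * r + 1\<close>.\<close>

definition cc :: "nat \<Rightarrow> nat \<Rightarrow> nat \<Rightarrow> int" where
  "cc r n i = (if i = r + 1 \<and> n = 2 * r then 2 else 1)"

inductive weyl_rel :: "nat \<Rightarrow> nat \<Rightarrow> falg \<Rightarrow> falg \<Rightarrow> bool" for r n :: nat where
  m_mi: "i \<in> {1..r + 1} \<Longrightarrow> weyl_rel r n (mm i * mi i) 1"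
| mi_m: "i \<in> {1..r + 1} \<Longrightarrow> weyl_rel r n (mi i * mm i) 1"
| m_m: "\<lbrakk>i \<in> {1..r + 1}; j \<in> {1..r + 1}\<rbrakk> \<Longrightarrow> weyl_rel r n (mm i * mm j) (mm j * mm i)"
| d_d: "\<lbrakk>i \<in> {1..r + 1}; j \<in> {1..r + 1}\<rbrakk> \<Longrightarrow> weyl_rel r n (dd i * dd j) (dd j * dd i)"
| x_x: "\<lbrakk>i \<in> {1..r + 1}; j \<in> {1..r + 1}\<rbrakk> \<Longrightarrow> weyl_rel r n (xx i * xx j) (xx j * xx i)"
| d_m: "\<lbrakk>i \<in> {1..r + 1}; j \<in> {1..r + 1}; i \<noteq> j\<rbrakk> \<Longrightarrow> weyl_rel r n (dd i * mm j) (mm j * dd i)"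
| x_m: "\<lbrakk>i \<in> {1..r + 1}; j \<in> {1..r + 1}; i \<noteq> j\<rbrakk> \<Longrightarrow> weyl_rel r n (xx i * mm j) (mm j * xx i)"
| d_x: "\<lbrakk>i \<in> {1..r + 1}; j \<in> {1..r + 1}; i \<noteq> j\<rbrakk> \<Longrightarrow> weyl_rel r n (dd i * xx j) (xx j * dd i)"
| d_m_same: "i \<in> {1..r + 1} \<Longrightarrow>
    weyl_rel r n (dd i * mm i) (scal (q powi cc r n i) * mm i * dd i)"
| x_m_same: "i \<in> {1..r + 1} \<Longrightarrow>
    weyl_rel r n (xx i * mm i) (scal (q powi (- cc r n i)) * mm i * xx i)"
| d_x_same: "i \<in> {1..r + 1} \<Longrightarrow>
    weyl_rel r n (dd i * xx i)
      (scal (inverse (q - inverse q)) *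
        (scal (q powi cc r n i) * mm i - scal (q powi (- cc r n i)) * mi i))"
| x_d_same: "i \<in> {1..r + 1} \<Longrightarrow>
    weyl_rel r n (xx i * dd i) (scal (inverse (q - inverse q)) * (mm i - mi i))"

text \<open>An ideal of \<open>free_alg r\<close> absorbs the constants, so the quotient ring is a
  \<open>\<rat>(q)\<close>-algebra. Its elements are cosets, i.e.\ sets of elements of the free algebra.\<close>

definition weyl_ideal :: "nat \<Rightarrow> nat \<Rightarrow> falg set" where
  "weyl_ideal r n = genideal (free_alg r) {a - b | a b. weyl_rel r n a b}"

definition Aq :: "nat \<Rightarrow> nat \<Rightarrow> falg set ring" where
  "Aq r n = free_alg r Quot weyl_ideal r n"

section \<open>The automorphisms\<close>

abbreviation NN :: "nat \<Rightarrow> nat" where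
  "NN n \<equiv> (n + 1) div 2"

text \<open>Images of the generators. The double-primed functions with parameters \<open>e\<close> and \<open>i\<close> stand
  for the maps with index \<open>i, -e\<close>. The image of \<open>Minv\<close> is the inverse of the image of \<open>M\<close>.\<close>

definition Tp_gen :: "nat \<Rightarrow> nat \<Rightarrow> int \<Rightarrow> nat \<Rightarrow> gen \<Rightarrow> falg" where
  "Tp_gen r n e i g =
    (if i < NN n then
       (case g of
          D j \<Rightarrow> if j = i + 1 then - (scal (q powi (- e)) * mpow (i + 1) (- e) * dd i)
                 else if j = i then mpow i (- e) * dd (i + 1) else dd j
        | X j \<Rightarrow> if j = i + 1 then - (scal (q powi e) * mpow (i + 1) e * xx i)
                 else if j = i then mpow i e * xx (i + 1) else xx j
        | M j \<Rightarrow> mm (transpose i (i + 1) j)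
        | Minv j \<Rightarrow> mi (transpose i (i + 1) j))
     else if n = 2 * r then
       (case g of
          D j \<Rightarrow> if j = r + 1 then scal (q powi e) * mpow r (- 2 * e) * dd (r + 1)
                 else if j = r then scal (q powi (- 2 * e)) * mpow r (- e) * mpow (r + 1) (- e) * dd r
                 else dd j
        | X j \<Rightarrow> if j = r + 1 then scal (q powi (- e)) * mpow r (2 * e) * xx (r + 1)
                 else if j = r then scal (q powi e) * mpow r e * mpow (r + 1) e * xx r
                 else xx j
        | M j \<Rightarrow> mm j
        | Minv j \<Rightarrow> mi j)
     else
       (case g of
          D j \<Rightarrow> if j = r + 1 then mpow (r + 1) (- e) * dd (r + 1) else dd j
        | X j \<Rightarrow> if j = r + 1 then scal (q powi (- e)) * mpow (r + 1) e * xx (r + 1) else xx j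
        | M j \<Rightarrow> mm j
        | Minv j \<Rightarrow> mi j))"

definition Tdp_gen :: "nat \<Rightarrow> nat \<Rightarrow> int \<Rightarrow> nat \<Rightarrow> gen \<Rightarrow> falg" where
  "Tdp_gen r n e i g =
    (if i < NN n then
       (case g of
          D j \<Rightarrow> if j = i + 1 then mpow (i + 1) e * dd i
                 else if j = i then - (scal (q powi e) * mpow i e * dd (i + 1)) else dd j
        | X j \<Rightarrow> if j = i + 1 then mpow (i + 1) (- e) * xx i
                 else if j = i then - (scal (q powi (- e)) * mpow i (- e) * xx (i + 1)) else xx j
        | M j \<Rightarrow> mm (transpose i (i + 1) j)
        | Minv j \<Rightarrow> mi (transpose i (i + 1) j))
     else if n = 2 * r then
       (case g of
          D j \<Rightarrow> if j = r + 1 then scal (q powi (- e)) * mpow r (2 * e) * dd (r + 1)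
                 else if j = r then scal (q powi (2 * e)) * mpow r e * mpow (r + 1) e * dd r
                 else dd j
        | X j \<Rightarrow> if j = r + 1 then scal (q powi e) * mpow r (- 2 * e) * xx (r + 1)
                 else if j = r then scal (q powi (- e)) * mpow r (- e) * mpow (r + 1) (- e) * xx r
                 else xx j
        | M j \<Rightarrow> mm j
        | Minv j \<Rightarrow> mi j)
     else
       (case g of
          D j \<Rightarrow> if j = r + 1 then mpow (r + 1) e * dd (r + 1) else dd j
        | X j \<Rightarrow> if j = r + 1 then scal (q powi e) * mpow (r + 1) (- e) * xx (r + 1) else xx j
        | M j \<Rightarrow> mm j
        | Minv j \<Rightarrow> mi j))"

text \<open>The map induced on the quotient: the image of a coset is the common coset of the images of
  its members (\<open>the_elem\<close> is specified only when there is exactly one such coset).\<close>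

definition induced :: "nat \<Rightarrow> nat \<Rightarrow> (gen \<Rightarrow> falg) \<Rightarrow> falg set \<Rightarrow> falg set" where
  "induced r n \<phi> A =
    the_elem ((\<lambda>p. weyl_ideal r n +>\<^bsub>free_alg r\<^esub> alg_hom \<phi> p) ` A)"

definition Tp :: "nat \<Rightarrow> nat \<Rightarrow> int \<Rightarrow> nat \<Rightarrow> falg set \<Rightarrow> falg set" where
  "Tp r n e i = induced r n (Tp_gen r n e i)"

definition Tdp :: "nat \<Rightarrow> nat \<Rightarrow> int \<Rightarrow> nat \<Rightarrow> falg set \<Rightarrow> falg set" where
  "Tdp r n e i = induced r n (Tdp_gen r n e i)"

section \<open>The action on polynomials\<close>

fun gen_mon :: "nat \<Rightarrow> nat \<Rightarrow> gen \<Rightarrow> expo \<Rightarrow> pols" where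
  "gen_mon r n (D i) a =
    (if Poly_Mapping.lookup a i = 0 then 0
     else Poly_Mapping.single (a - Poly_Mapping.single i 1)
            (qint (cc r n i * int (Poly_Mapping.lookup a i))))"
| "gen_mon r n (X i) a = Poly_Mapping.single (a + Poly_Mapping.single i 1) 1"
| "gen_mon r n (M i) a =
    Poly_Mapping.single a (q powi (cc r n i * int (Poly_Mapping.lookup a i)))"
| "gen_mon r n (Minv i) a =
    Poly_Mapping.single a (q powi (- cc r n i * int (Poly_Mapping.lookup a i)))"

definition free_act :: "nat \<Rightarrow> nat \<Rightarrow> falg \<Rightarrow> pols \<Rightarrow> pols" where
  "free_act r n p f = lin_ext (\<lambda>w. foldr (\<lambda>g. lin_ext (gen_mon r n g)) (letters w) f) p"

definition act :: "nat \<Rightarrow> nat \<Rightarrow> falg set \<Rightarrow> pols \<Rightarrow> pols" where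
  "act r n A f = the_elem ((\<lambda>p. free_act r n p f) ` A)"

section \<open>The operators on polynomials\<close>

text \<open>The exponents \<open>(a\<^sup>2 + 3 a) / 2\<close> and \<open>(a\<^sup>2 - a) / 2\<close> are integers, so \<open>div\<close> is exact here.\<close>

definition swap_expo :: "nat \<Rightarrow> expo \<Rightarrow> expo" where
  "swap_expo i a = Poly_Mapping.map_key (transpose i (i + 1)) a"

definition OTp_mon :: "nat \<Rightarrow> nat \<Rightarrow> int \<Rightarrow> nat \<Rightarrow> expo \<Rightarrow> pols" where
  "OTp_mon r n e i a =
    (let \<alpha> = (\<lambda>j. int (Poly_Mapping.lookup a j)) in
     if i < NN n then
       Poly_Mapping.single (swap_expo i a)
         ((- (q powi (- e))) powi (- \<alpha> (i + 1)) * q powi (e * \<alpha> i * \<alpha> (i + 1)))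
     else if n = 2 * r then
       Poly_Mapping.single a
         (q powi (e * (((\<alpha> r)\<^sup>2 + 3 * \<alpha> r) div 2) - e * \<alpha> (r + 1) + 2 * e * \<alpha> r * \<alpha> (r + 1)))
     else
       Poly_Mapping.single a (q powi (e * (((\<alpha> (r + 1))\<^sup>2 - \<alpha> (r + 1)) div 2))))"

definition OTdp_mon :: "nat \<Rightarrow> nat \<Rightarrow> int \<Rightarrow> nat \<Rightarrow> expo \<Rightarrow> pols" where
  "OTdp_mon r n e i a =
    (let \<alpha> = (\<lambda>j. int (Poly_Mapping.lookup a j)) in
     if i < NN n then
       Poly_Mapping.single (swap_expo i a)
         ((- (q powi (- e))) powi (\<alpha> i) * q powi (- e * \<alpha> i * \<alpha> (i + 1)))
     else if n = 2 * r then
       Poly_Mapping.single a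
         (q powi (- e * (((\<alpha> r)\<^sup>2 + 3 * \<alpha> r) div 2) + e * \<alpha> (r + 1) - 2 * e * \<alpha> r * \<alpha> (r + 1)))
     else
       Poly_Mapping.single a (q powi (- e * (((\<alpha> (r + 1))\<^sup>2 - \<alpha> (r + 1)) div 2))))"

definition OTp :: "nat \<Rightarrow> nat \<Rightarrow> int \<Rightarrow> nat \<Rightarrow> pols \<Rightarrow> pols" where
  "OTp r n e i = lin_ext (OTp_mon r n e i)"

definition OTdp :: "nat \<Rightarrow> nat \<Rightarrow> int \<Rightarrow> nat \<Rightarrow> pols \<Rightarrow> pols" where
  "OTdp r n e i = lin_ext (OTdp_mon r n e i)"

end

theory Submission
  imports Defs
begin

text \<open>
All the automorphisms \<open>T\<^sub>i\<close> have the same shape: an involution \<open>\<sigma>\<close> of the indices (a neighbour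
transposition or the identity) sends \<open>m\<^sub>j\<close> to \<open>m\<close> at \<open>\<sigma> j\<close>, and \<open>d\<^sub>j\<close> and \<open>x\<^sub>j\<close> to \<open>d\<close> and \<open>x\<close> at \<open>\<sigma> j\<close>,
multiplied from the left by scalar multiples of Laurent monomials in the torus generators \<open>m\<^sub>k\<close>; the
monomials in front of \<open>d\<close> and of \<open>x\<close> are inverse to each other up to a scalar. The operators on
polynomials are \<open>X\<^sup>a \<mapsto> \<kappa>(a) X\<^bsup>\<sigma> a\<^esup>\<close> with scalars \<open>\<kappa>(a)\<close>.

For such data everything reduces to three numerical conditions, collected in the locales
\<open>weyl_twist\<close> and \<open>weyl_twist_operator\<close>. Since torus generators \<open>q\<close>-commute with all generators, the
substitution respects the defining relations if a pairing of the exponents is symmetric and the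
scalars in front of \<open>d\<^sub>j\<close> and \<open>x\<^sub>j\<close> multiply to a specific power of \<open>q\<close> (lemma \<open>weyl_rel_\<phi>\<close>). Hence it
maps the ideal of relations into itself and induces a map of the quotient. The third condition is a
recursion for \<open>\<kappa>\<close>, which is the intertwining property for \<open>x\<^sub>j\<close> on monomials; the property for \<open>d\<^sub>j\<close>
follows from it and the second condition (lemma \<open>twist_gen\<close>). Since the letters of a word act one
after the other, it extends from the generators to words, by linearity to the free algebra and
then to cosets (lemma \<open>twist_act\<close>).

The conditions are checked for three kinds of twists: transpositions, and the diagonal twist at the
last index for even and for odd \<open>n\<close>. The double-primed family is the same for other
parameters; at the last index it is the primed one with \<open>-e\<close>.

The braid relations do not depend on the special form of the scalars. A transposition operator
multiplies by a function of the two exchanged exponents, and composing such operators along either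
side of a braid relation evaluates these functions at the same pairs of exponents.
\<close>

section \<open>Linear extensions and the free algebra\<close>

text \<open>All maps below, on the free algebra as well as on polynomials, are additive, and on basis elements
they are given by explicit formulas; identities between them are proved by comparing the latter.\<close>

lemma additive_eq_if_eq_on_singles:
  fixes F G :: "('a \<Rightarrow>\<^sub>0 'b::monoid_add) \<Rightarrow> 'c::cancel_comm_monoid_add"
  assumes "\<And>f g. F (f + g) = F f + F g" and "\<And>f g. G (f + g) = G f + G g"
    and single: "\<And>w c. F (Poly_Mapping.single w c) = G (Poly_Mapping.single w c)"
  shows "F f = G f"
proof (induction f rule: Poly_Mapping.update_induct)
  case const
  show ?case using single[of undefined 0] by simp
next
  case (update f a b)
  have "Poly_Mapping.update a b f = f + Poly_Mapping.single a b"
    using update(1) by (intro poly_mapping_eqI)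
      (auto simp: lookup_update lookup_add lookup_single when_def not_in_keys_iff_lookup_eq_zero)
  then show ?case using assms update by simp
qed

lemma scal_mult: "scal (a * b) = scal a * scal b"
  by (simp add: scal_def mult_single)

lemma scal_add: "scal (a + b) = scal a + scal b"
  by (simp add: scal_def single_add)

lemma scal_uminus: "scal (- a) = - scal a"
  by (simp add: scal_def single_uminus)

lemma scal_0 [simp]: "scal 0 = 0"
  by (simp add: scal_def)

lemma scal_1 [simp]: "scal 1 = 1"
  by (simp add: scal_def)

lemma scal_times_single [simp]:
  "scal c * Poly_Mapping.single w d = Poly_Mapping.single w (c * d)"
  by (simp add: scal_def mult_single)

lemma scal_central: "f * scal c = scal c * f"
  by (rule additive_eq_if_eq_on_singles[of "\<lambda>f. f * scal c" "\<lambda>f. scal c * f"])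
    (simp_all add: distrib_left distrib_right scal_def mult_single mult.commute)

lemma scal_left_commute: "f * (scal c * g) = scal c * (f * g)"
  by (metis mult.assoc scal_central)

lemma scal_scal_commute: "scal a * (scal b * f) = scal b * (scal a * f)"
  by (metis mult.assoc scal_central)

lemma lin_ext_superset:
  assumes "finite S" "Poly_Mapping.keys f \<subseteq> S"
  shows "lin_ext \<phi> f = (\<Sum>w\<in>S. scal (Poly_Mapping.lookup f w) * \<phi> w)"
  unfolding lin_ext_def using assms
  by (intro sum.mono_neutral_left) (auto simp: not_in_keys_iff_lookup_eq_zero)

lemma lin_ext_add: "lin_ext \<phi> (f + g) = lin_ext \<phi> f + lin_ext \<phi> g"
proof -
  let ?S = "Poly_Mapping.keys f \<union> Poly_Mapping.keys g"
  have "Poly_Mapping.keys (f + g) \<subseteq> ?S" by (rule Poly_Mapping.keys_add)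
  then show ?thesis
    by (simp add: lin_ext_superset[of ?S] lookup_add scal_add distrib_right sum.distrib)
qed

lemma lin_ext_single [simp]: "lin_ext \<phi> (Poly_Mapping.single w c) = scal c * \<phi> w"
  by (simp add: lin_ext_superset[of "{w}"])

lemma lin_ext_0 [simp]: "lin_ext \<phi> 0 = 0"
  by (simp add: lin_ext_def)

lemma lin_ext_1 [simp]: "lin_ext \<phi> 1 = \<phi> 0"
  using lin_ext_single[of \<phi> 0 1] by simp

lemma lin_ext_uminus: "lin_ext \<phi> (- f) = - lin_ext \<phi> f"
  using lin_ext_add[of \<phi> f "- f"] by (simp add: eq_neg_iff_add_eq_0 add.commute)

lemma lin_ext_diff: "lin_ext \<phi> (f - g) = lin_ext \<phi> f - lin_ext \<phi> g"
  using lin_ext_add[of \<phi> f "- g"] by (simp add: lin_ext_uminus)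

lemma lin_ext_scal: "lin_ext \<phi> (scal c * f) = scal c * lin_ext \<phi> f"
  by (rule additive_eq_if_eq_on_singles[of "\<lambda>f. lin_ext \<phi> (scal c * f)"])
    (simp_all add: lin_ext_add distrib_left scal_mult mult.assoc)

lemma letters_plus [simp]: "letters (u + v) = letters u @ letters v"
  by (simp add: plus_free_monoid_def)

lemma letters_0 [simp]: "letters 0 = []"
  by (simp add: zero_free_monoid_def)

lemma alg_hom_add: "alg_hom \<phi> (p + s) = alg_hom \<phi> p + alg_hom \<phi> s"
  by (simp add: alg_hom_def lin_ext_add)

lemma alg_hom_diff: "alg_hom \<phi> (p - s) = alg_hom \<phi> p - alg_hom \<phi> s"
  by (simp add: alg_hom_def lin_ext_diff)

lemma alg_hom_uminus: "alg_hom \<phi> (- p) = - alg_hom \<phi> p"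
  by (simp add: alg_hom_def lin_ext_uminus)

lemma alg_hom_0 [simp]: "alg_hom \<phi> 0 = 0"
  by (simp add: alg_hom_def)

lemma alg_hom_1 [simp]: "alg_hom \<phi> 1 = 1"
  by (simp add: alg_hom_def)

lemma alg_hom_gen_el [simp]: "alg_hom \<phi> (gen_el g) = \<phi> g"
  by (simp add: alg_hom_def gen_el_def)

lemma alg_hom_scal [simp]: "alg_hom \<phi> (scal c) = scal c"
  by (simp add: alg_hom_def scal_def)

lemma alg_hom_mult: "alg_hom \<phi> (p * s) = alg_hom \<phi> p * alg_hom \<phi> s"
proof (rule additive_eq_if_eq_on_singles[of "\<lambda>p. alg_hom \<phi> (p * s)"])
  fix w c
  show "alg_hom \<phi> (Poly_Mapping.single w c * s) = alg_hom \<phi> (Poly_Mapping.single w c) * alg_hom \<phi> s"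
    by (rule additive_eq_if_eq_on_singles[of "\<lambda>s. alg_hom \<phi> (Poly_Mapping.single w c * s)"])
      (simp_all add: alg_hom_add distrib_left, simp add: mult_single alg_hom_def scal_mult mult.assoc
        scal_left_commute[of "prod_list _"])
qed (simp_all add: alg_hom_add distrib_right)

section \<open>The action of the free algebra on polynomials\<close>

lemma free_act_add: "free_act r n (p + s) f = free_act r n p f + free_act r n s f"
  by (simp add: free_act_def lin_ext_add)

lemma free_act_diff: "free_act r n (p - s) f = free_act r n p f - free_act r n s f"
  by (simp add: free_act_def lin_ext_diff)

lemma free_act_uminus: "free_act r n (- p) f = - free_act r n p f"
  by (simp add: free_act_def lin_ext_uminus)

lemma free_act_0 [simp]: "free_act r n 0 f = 0"
  by (simp add: free_act_def)

lemma free_act_1 [simp]: "free_act r n 1 f = f"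
  by (simp add: free_act_def)

lemma free_act_gen_el [simp]: "free_act r n (gen_el g) f = lin_ext (gen_mon r n g) f"
  by (simp add: free_act_def gen_el_def)

lemma free_act_scal [simp]: "free_act r n (scal c) f = scal c * f"
  by (simp add: free_act_def scal_def)

lemma word_act_add:
  "foldr (\<lambda>g. lin_ext (gen_mon r n g)) w (f + h) =
   foldr (\<lambda>g. lin_ext (gen_mon r n g)) w f + foldr (\<lambda>g. lin_ext (gen_mon r n g)) w h"
  by (induction w) (simp_all add: lin_ext_add)

lemma word_act_scal:
  "foldr (\<lambda>g. lin_ext (gen_mon r n g)) w (scal c * f) =
   scal c * foldr (\<lambda>g. lin_ext (gen_mon r n g)) w f"
  by (induction w) (simp_all add: lin_ext_scal)

lemma free_act_single: "free_act r n (Poly_Mapping.single w c) f =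
    scal c * foldr (\<lambda>g. lin_ext (gen_mon r n g)) (letters w) f"
  by (simp add: free_act_def)

lemma free_act_add_right: "free_act r n p (f + h) = free_act r n p f + free_act r n p h"
  by (rule additive_eq_if_eq_on_singles[of "\<lambda>p. free_act r n p (f + h)"])
    (simp_all add: free_act_add free_act_single word_act_add distrib_left add_ac)

lemma free_act_scal_right: "free_act r n p (scal c * f) = scal c * free_act r n p f"
  by (rule additive_eq_if_eq_on_singles[of "\<lambda>p. free_act r n p (scal c * f)"])
    (simp_all add: free_act_add free_act_single word_act_scal distrib_left
        scal_scal_commute)

lemma free_act_0_right [simp]: "free_act r n p 0 = 0"
  using free_act_scal_right[of r n p 0 0] by simp

lemma free_act_mult: "free_act r n (p * s) f = free_act r n p (free_act r n s f)"
proof (rule additive_eq_if_eq_on_singles[of "\<lambda>p. free_act r n (p * s) f"])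
  fix w c
  show "free_act r n (Poly_Mapping.single w c * s) f
      = free_act r n (Poly_Mapping.single w c) (free_act r n s f)"
    by (rule additive_eq_if_eq_on_singles[of "\<lambda>s. free_act r n (Poly_Mapping.single w c * s) f"])
      (simp_all add: free_act_add free_act_add_right distrib_left,
        simp add: mult_single free_act_single word_act_scal scal_mult mult.assoc)
qed (simp_all add: free_act_add distrib_right)

lemma q_neq_0 [simp]: "q \<noteq> 0"
  by (simp add: q_def Zero_fract_def eq_fract)

lemma q_powi_neq_0 [simp]: "q powi k \<noteq> 0"
  by (simp add: power_int_not_zero)

abbreviation mon :: "expo \<Rightarrow> Qq \<Rightarrow> pols" where
  "mon \<equiv> Poly_Mapping.single"

text \<open>The action of a fixed element is linear in the polynomial, so two elements of the free algebra act
alike as soon as they do so on monomials. All relations are tested in this way.\<close>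

lemma free_act_eq_if_mon:
  assumes "\<And>a. free_act r n p (mon a 1) = free_act r n s (mon a 1)"
  shows "free_act r n p f = free_act r n s f"
proof (rule additive_eq_if_eq_on_singles[of "free_act r n p" "free_act r n s"])
  fix w c
  show "free_act r n p (mon w c) = free_act r n s (mon w c)"
    using assms[of w] free_act_scal_right[of r n _ c "mon w 1"] by simp
qed (simp_all add: free_act_add_right)

lemma expo_minus_plus:
  "Poly_Mapping.lookup a i \<noteq> 0 \<Longrightarrow>
    a - Poly_Mapping.single i (Suc 0) + Poly_Mapping.single i (Suc 0) = a"
  by (intro poly_mapping_eqI) (auto simp: lookup_add lookup_minus lookup_single when_def)

lemma expo_minus_commute:
  "(a::expo) - Poly_Mapping.single i (Suc 0) - Poly_Mapping.single j (Suc 0)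
    = a - Poly_Mapping.single j (Suc 0) - Poly_Mapping.single i (Suc 0)"
  by (intro poly_mapping_eqI) (auto simp: lookup_minus lookup_single when_def)

lemma expo_plus_minus_commute:
  "i \<noteq> j \<Longrightarrow> (a::expo) + Poly_Mapping.single j (Suc 0) - Poly_Mapping.single i (Suc 0)
    = a - Poly_Mapping.single i (Suc 0) + Poly_Mapping.single j (Suc 0)"
  by (intro poly_mapping_eqI) (auto simp: lookup_add lookup_minus lookup_single when_def)

text \<open>On a monomial the relation for \<open>d\<^sub>i x\<^sub>i\<close> is the definition of the \<open>q\<close>-integer at \<open>c\<^sub>i (a\<^sub>i + 1)\<close>, and
the one for \<open>x\<^sub>i d\<^sub>i\<close> is its definition at \<open>c\<^sub>i a\<^sub>i\<close>; for \<open>a\<^sub>i = 0\<close> this \<open>q\<close>-integer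
is \<open>0\<close>, in agreement with \<open>d\<^sub>i\<close> killing the monomials without \<open>X\<^sub>i\<close>. The other relations compare exponents.\<close>

lemma free_act_weyl_rel:
  assumes "weyl_rel r n p s"
  shows "free_act r n p f = free_act r n s f"
  using assms
proof (induction rule: weyl_rel.induct)
  case (d_d i j)
  show ?case
    by (rule free_act_eq_if_mon, cases "i = j")
      (auto simp: free_act_mult lookup_minus lookup_single mult_ac expo_minus_commute[of _ i j])
next
  case (x_x i j)
  show ?case
    by (rule free_act_eq_if_mon) (auto simp: free_act_mult add_ac)
next
  case (d_x i j)
  then show ?case
    by - (rule free_act_eq_if_mon,
      simp add: free_act_mult lookup_add lookup_single expo_plus_minus_commute)
next
  case (d_m i j)
  then show ?case
    by - (rule free_act_eq_if_mon, simp add: free_act_mult lookup_minus lookup_single mult_ac)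
next
  case (x_m i j)
  then show ?case
    by - (rule free_act_eq_if_mon, simp add: free_act_mult lookup_add lookup_single)
next
  case (d_m_same i)
  show ?case
    by (rule free_act_eq_if_mon)
      (auto simp: free_act_mult lookup_minus of_nat_diff algebra_simps power_int_diff)
next
  case (x_m_same i)
  show ?case
    by (rule free_act_eq_if_mon)
      (auto simp: free_act_mult lookup_add power_int_minus distrib_left power_int_add
        mult.assoc[symmetric])
next
  case (d_x_same i)
  show ?case
    by (rule free_act_eq_if_mon)
      (auto simp: free_act_mult free_act_diff lookup_add qint_def power_int_add power_int_minus power_int_diff
        divide_inverse algebra_simps single_diff[symmetric])
next
  case (x_d_same i)
  show ?case
    by (rule free_act_eq_if_mon)
      (auto simp: free_act_mult free_act_diff expo_minus_plus qint_def divide_inverse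
        left_diff_distrib right_diff_distrib mult.commute[of _ "inverse (q - inverse q)"]
        single_diff[symmetric])
qed (rule free_act_eq_if_mon, simp add: free_act_mult mult_ac power_int_minus)+

section \<open>The free algebra as a ring and the ideal of relations\<close>

lemma carrier_free_alg_iff:
  "p \<in> carrier (free_alg r) \<longleftrightarrow> (\<forall>w \<in> Poly_Mapping.keys p. set (letters w) \<subseteq> gens r)"
  by (simp add: free_alg_def)

lemma free_alg_simps [simp]:
  "mult (free_alg r) = (*)" "one (free_alg r) = 1" "zero (free_alg r) = 0" "add (free_alg r) = (+)"
  by (simp_all add: free_alg_def)

lemma scal_carrier: "scal c \<in> carrier (free_alg r)"
  by (auto simp: carrier_free_alg_iff scal_def split: if_splits)

lemma one_carrier: "1 \<in> carrier (free_alg r)"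
  using scal_carrier[of 1] by simp

lemma zero_carrier: "0 \<in> carrier (free_alg r)"
  by (simp add: carrier_free_alg_iff)

lemma gen_el_carrier: "g \<in> gens r \<Longrightarrow> gen_el g \<in> carrier (free_alg r)"
  by (simp add: carrier_free_alg_iff gen_el_def)

lemma add_carrier:
  "p \<in> carrier (free_alg r) \<Longrightarrow> s \<in> carrier (free_alg r) \<Longrightarrow> p + s \<in> carrier (free_alg r)"
  using Poly_Mapping.keys_add[of p s] by (fastforce simp: carrier_free_alg_iff)

lemma uminus_carrier: "p \<in> carrier (free_alg r) \<Longrightarrow> - p \<in> carrier (free_alg r)"
  by (simp add: carrier_free_alg_iff)

lemma diff_carrier:
  "p \<in> carrier (free_alg r) \<Longrightarrow> s \<in> carrier (free_alg r) \<Longrightarrow> p - s \<in> carrier (free_alg r)"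
  using add_carrier[of p r "- s"] by (simp add: uminus_carrier)

lemma mult_carrier:
  "p \<in> carrier (free_alg r) \<Longrightarrow> s \<in> carrier (free_alg r) \<Longrightarrow> p * s \<in> carrier (free_alg r)"
  using Poly_Mapping.keys_mult[of p s] by (fastforce simp: carrier_free_alg_iff)

lemma sum_carrier:
  "(\<And>x. x \<in> S \<Longrightarrow> f x \<in> carrier (free_alg r)) \<Longrightarrow> sum f S \<in> carrier (free_alg r)"
  by (induction S rule: infinite_finite_induct) (simp_all add: zero_carrier add_carrier)

lemma prod_list_carrier:
  "(\<And>p. p \<in> set ps \<Longrightarrow> p \<in> carrier (free_alg r)) \<Longrightarrow> prod_list ps \<in> carrier (free_alg r)"
  by (induction ps) (simp_all add: one_carrier mult_carrier)

lemma power_carrier: "p \<in> carrier (free_alg r) \<Longrightarrow> p ^ k \<in> carrier (free_alg r)"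
  by (induction k) (simp_all add: one_carrier mult_carrier)

lemmas carrier_intros = scal_carrier one_carrier zero_carrier gen_el_carrier add_carrier
  uminus_carrier diff_carrier mult_carrier power_carrier

lemma gens_simps [simp]:
  "D i \<in> gens r \<longleftrightarrow> i \<in> {1..r + 1}" "X i \<in> gens r \<longleftrightarrow> i \<in> {1..r + 1}"
  "M i \<in> gens r \<longleftrightarrow> i \<in> {1..r + 1}" "Minv i \<in> gens r \<longleftrightarrow> i \<in> {1..r + 1}"
  by (auto simp: gens_def)

lemma alg_hom_carrier:
  assumes "\<And>g. g \<in> gens r \<Longrightarrow> \<phi> g \<in> carrier (free_alg r)" "p \<in> carrier (free_alg r)"
  shows "alg_hom \<phi> p \<in> carrier (free_alg r)"
  unfolding alg_hom_def lin_ext_def using assms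
  by (intro sum_carrier mult_carrier scal_carrier prod_list_carrier)
    (auto simp: carrier_free_alg_iff)

lemma ring_free_alg: "ring (free_alg r)"
proof (rule ringI)
  show "abelian_group (free_alg r)"
    by (rule abelian_groupI)
      (auto simp: carrier_intros add_ac intro: bexI[of _ "- x" for x] uminus_carrier)
  show "monoid (free_alg r)"
    by (rule monoidI) (auto simp: carrier_intros mult.assoc)
qed (simp_all add: distrib_left distrib_right)

lemma weyl_rel_carrier:
  "weyl_rel r n a b \<Longrightarrow> a \<in> carrier (free_alg r) \<and> b \<in> carrier (free_alg r)"
  by (induction rule: weyl_rel.induct) (simp_all add: carrier_intros)

lemma ideal_weyl_ideal: "ideal (weyl_ideal r n) (free_alg r)"
  unfolding weyl_ideal_def
  by (rule ring.genideal_ideal[OF ring_free_alg])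
    (auto dest: weyl_rel_carrier intro: diff_carrier)

lemma weyl_ideal_subset: "weyl_ideal r n \<subseteq> carrier (free_alg r)"
  by (rule additive_subgroup.a_subset[OF ideal.axioms(1)[OF ideal_weyl_ideal]])

lemma zero_weyl_ideal: "0 \<in> weyl_ideal r n"
  using additive_subgroup.zero_closed[OF ideal.axioms(1)[OF ideal_weyl_ideal]] by simp

lemma add_weyl_ideal:
  "p \<in> weyl_ideal r n \<Longrightarrow> s \<in> weyl_ideal r n \<Longrightarrow> p + s \<in> weyl_ideal r n"
  using additive_subgroup.a_closed[OF ideal.axioms(1)[OF ideal_weyl_ideal], of p r n s] by simp

lemma mult_left_weyl_ideal:
  "p \<in> weyl_ideal r n \<Longrightarrow> s \<in> carrier (free_alg r) \<Longrightarrow> s * p \<in> weyl_ideal r n"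
  using ideal.I_l_closed[OF ideal_weyl_ideal, of p r n s] by simp

lemma mult_right_weyl_ideal:
  "p \<in> weyl_ideal r n \<Longrightarrow> s \<in> carrier (free_alg r) \<Longrightarrow> p * s \<in> weyl_ideal r n"
  using ideal.I_r_closed[OF ideal_weyl_ideal, of p r n s] by simp

lemma uminus_weyl_ideal: "p \<in> weyl_ideal r n \<Longrightarrow> - p \<in> weyl_ideal r n"
  using mult_left_weyl_ideal[of p r n "- 1"] by (simp add: uminus_carrier one_carrier)

lemma weyl_relD: "weyl_rel r n a b \<Longrightarrow> a - b \<in> weyl_ideal r n"
  unfolding weyl_ideal_def
  by (rule subsetD[OF ring.genideal_self[OF ring_free_alg]])
    (auto dest: weyl_rel_carrier intro: diff_carrier)

lemma weyl_ideal_minimal: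
  assumes "ideal I (free_alg r)" "\<And>a b. weyl_rel r n a b \<Longrightarrow> a - b \<in> I"
  shows "weyl_ideal r n \<subseteq> I"
  unfolding weyl_ideal_def using assms
  by (intro ring.genideal_minimal[OF ring_free_alg]) auto

lemma a_inv_free_alg:
  assumes "p \<in> carrier (free_alg r)" shows "a_inv (free_alg r) p = - p"
  by (rule abelian_group.minus_equality[OF ring.is_abelian_group[OF ring_free_alg]])
    (use assms in \<open>simp_all add: uminus_carrier\<close>)

lemma ideal_free_algI:
  assumes "I \<subseteq> carrier (free_alg r)" "0 \<in> I"
    and "\<And>a b. a \<in> I \<Longrightarrow> b \<in> I \<Longrightarrow> a + b \<in> I" "\<And>a. a \<in> I \<Longrightarrow> - a \<in> I"
    and "\<And>a x. a \<in> I \<Longrightarrow> x \<in> carrier (free_alg r) \<Longrightarrow> x * a \<in> I"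
    and "\<And>a x. a \<in> I \<Longrightarrow> x \<in> carrier (free_alg r) \<Longrightarrow> a * x \<in> I"
  shows "ideal I (free_alg r)"
proof (rule idealI[OF ring_free_alg])
  show "subgroup I (add_monoid (free_alg r))"
  proof (rule group.subgroupI)
    show "group (add_monoid (free_alg r))"
      using abelian_group.a_group[OF ring.is_abelian_group[OF ring_free_alg]] .
  next
    fix a assume "a \<in> I"
    then show "inv\<^bsub>add_monoid (free_alg r)\<^esub> a \<in> I"
      using assms(1,4) a_inv_free_alg[of a r] by (auto simp: a_inv_def)
  qed (use assms in auto)
qed (use assms in auto)

text \<open>The elements that annihilate all polynomials form an ideal, and it contains the relations; so it
contains the ideal that they generate. This makes the action of a coset well defined.\<close>

lemma weyl_ideal_acts_trivially:
  assumes "p \<in> weyl_ideal r n"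
  shows "free_act r n p f = 0"
proof -
  let ?I = "{p \<in> carrier (free_alg r). \<forall>f. free_act r n p f = 0}"
  have "weyl_ideal r n \<subseteq> ?I"
  proof (rule weyl_ideal_minimal)
    show "ideal ?I (free_alg r)"
      by (rule ideal_free_algI)
        (auto simp: carrier_intros free_act_add free_act_uminus free_act_mult)
  qed (auto simp: free_act_diff free_act_weyl_rel dest: weyl_rel_carrier intro: diff_carrier)
  then show ?thesis using assms by auto
qed

text \<open>The preimage of the ideal under a substitution homomorphism is again an ideal, so compatibility
with the ideal only has to be tested on the defining relations.\<close>

lemma alg_hom_weyl_ideal:
  assumes gens: "\<And>g. g \<in> gens r \<Longrightarrow> \<phi> g \<in> carrier (free_alg r)"
    and rels: "\<And>a b. weyl_rel r n a b \<Longrightarrow> alg_hom \<phi> a - alg_hom \<phi> b \<in> weyl_ideal r n"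
    and "p \<in> weyl_ideal r n"
  shows "alg_hom \<phi> p \<in> weyl_ideal r n"
proof -
  let ?I = "{p \<in> carrier (free_alg r). alg_hom \<phi> p \<in> weyl_ideal r n}"
  have "weyl_ideal r n \<subseteq> ?I"
  proof (rule weyl_ideal_minimal)
    show "ideal ?I (free_alg r)"
      by (rule ideal_free_algI)
        (auto simp: carrier_intros alg_hom_add alg_hom_uminus alg_hom_mult zero_weyl_ideal
          intro: add_weyl_ideal uminus_weyl_ideal mult_left_weyl_ideal mult_right_weyl_ideal
            alg_hom_carrier gens)
  qed (auto simp: alg_hom_diff rels dest: weyl_rel_carrier intro: diff_carrier)
  then show ?thesis using assms(3) by auto
qed

lemma mem_coset_weyl_ideal:
  assumes "p \<in> carrier (free_alg r)"
  shows "t \<in> weyl_ideal r n +>\<^bsub>free_alg r\<^esub> p \<longleftrightarrow> (\<exists>h \<in> weyl_ideal r n. t = h + p)"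
  by (auto simp: a_r_coset_def')

lemma coset_weyl_ideal_eqI:
  assumes "p \<in> carrier (free_alg r)" "s \<in> carrier (free_alg r)" "p - s \<in> weyl_ideal r n"
  shows "weyl_ideal r n +>\<^bsub>free_alg r\<^esub> p = weyl_ideal r n +>\<^bsub>free_alg r\<^esub> s"
proof -
  interpret ideal "weyl_ideal r n" "free_alg r" by (rule ideal_weyl_ideal)
  have "p \<in> weyl_ideal r n +>\<^bsub>free_alg r\<^esub> s"
    using assms by (auto simp: mem_coset_weyl_ideal intro!: bexI[of _ "p - s"])
  then show ?thesis using a_repr_independence'[OF _ assms(2)] by simp
qed

lemma Aq_carrierE:
  assumes "A \<in> carrier (Aq r n)"
  obtains p where "p \<in> carrier (free_alg r)" "A = weyl_ideal r n +>\<^bsub>free_alg r\<^esub> p"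
  using assms by (auto simp: Aq_def FactRing_def A_RCOSETS_def')

text \<open>All representatives act alike, so the action of a coset can be computed with any of them.\<close>

lemma act_coset:
  assumes "p \<in> carrier (free_alg r)"
  shows "act r n (weyl_ideal r n +>\<^bsub>free_alg r\<^esub> p) f = free_act r n p f"
proof -
  have "p \<in> weyl_ideal r n +>\<^bsub>free_alg r\<^esub> p"
    using zero_weyl_ideal assms by (auto simp: mem_coset_weyl_ideal intro!: bexI[of _ 0])
  then have "(\<lambda>p. free_act r n p f) ` (weyl_ideal r n +>\<^bsub>free_alg r\<^esub> p) = {free_act r n p f}"
    using assms by (auto simp: mem_coset_weyl_ideal free_act_add weyl_ideal_acts_trivially image_iff)
  then show ?thesis by (simp add: act_def)
qed

text \<open>Two representatives of a coset differ by an element of the ideal, and so do their images. Hence the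
images determine a single coset, which is the value selected in the definition of the induced map.\<close>

lemma induced_coset:
  assumes gens: "\<And>g. g \<in> gens r \<Longrightarrow> \<phi> g \<in> carrier (free_alg r)"
    and rels: "\<And>a b. weyl_rel r n a b \<Longrightarrow> alg_hom \<phi> a - alg_hom \<phi> b \<in> weyl_ideal r n"
    and p: "p \<in> carrier (free_alg r)"
  shows "induced r n \<phi> (weyl_ideal r n +>\<^bsub>free_alg r\<^esub> p)
    = weyl_ideal r n +>\<^bsub>free_alg r\<^esub> alg_hom \<phi> p"
proof -
  let ?C = "\<lambda>p. weyl_ideal r n +>\<^bsub>free_alg r\<^esub> p"
  have "p \<in> ?C p"
    using zero_weyl_ideal p by (auto simp: mem_coset_weyl_ideal intro!: bexI[of _ 0])
  moreover have "?C (alg_hom \<phi> t) = ?C (alg_hom \<phi> p)" if t: "t \<in> ?C p" for t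
  proof -
    obtain h where h: "h \<in> weyl_ideal r n" "t = h + p"
      using t p by (auto simp: mem_coset_weyl_ideal)
    have "t \<in> carrier (free_alg r)" using h weyl_ideal_subset p by (auto intro: add_carrier)
    then have "alg_hom \<phi> t \<in> carrier (free_alg r)" "alg_hom \<phi> p \<in> carrier (free_alg r)"
      using gens p by (simp_all add: alg_hom_carrier)
    then show ?thesis
      using h alg_hom_weyl_ideal[OF gens rels h(1)]
      by (intro coset_weyl_ideal_eqI) (simp_all add: alg_hom_add)
  qed
  ultimately have "(\<lambda>p. ?C (alg_hom \<phi> p)) ` ?C p = {?C (alg_hom \<phi> p)}"
    by blast
  then show ?thesis by (simp add: induced_def)
qed

section \<open>\<open>q\<close>-commutation in the quotient\<close>

text \<open>Calculations in the quotient are carried out with representatives modulo the ideal. Membership in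
the subalgebra on the generators with index at most \<open>r + 1\<close> is part of the notion, because the
ideal absorbs only multiplication by such elements.\<close>

definition weyl_cong :: "nat \<Rightarrow> nat \<Rightarrow> falg \<Rightarrow> falg \<Rightarrow> bool" where
  "weyl_cong r n p s \<longleftrightarrow>
    p \<in> carrier (free_alg r) \<and> s \<in> carrier (free_alg r) \<and> p - s \<in> weyl_ideal r n"

text \<open>Apart from the inverse pairs and the formulas for \<open>d\<^sub>i x\<^sub>i\<close> and \<open>x\<^sub>i d\<^sub>i\<close>, all relations say that two
generators commute up to a power of \<open>q\<close>. Such factors multiply along products in either argument, so the factor for two
monomials is read off from their letters.\<close>

definition qcomm :: "nat \<Rightarrow> nat \<Rightarrow> Qq \<Rightarrow> falg \<Rightarrow> falg \<Rightarrow> bool" where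
  "qcomm r n c p s \<longleftrightarrow> p \<in> carrier (free_alg r) \<and> s \<in> carrier (free_alg r) \<and>
    weyl_cong r n (p * s) (scal c * (s * p))"

context
  fixes r n :: nat
begin

abbreviation cong_rn (infix "\<approx>" 50) where
  "p \<approx> s \<equiv> weyl_cong r n p s"

lemma weyl_cong_refl: "p \<in> carrier (free_alg r) \<Longrightarrow> p \<approx> p"
  by (simp add: weyl_cong_def zero_weyl_ideal)

lemma weyl_cong_sym: "p \<approx> s \<Longrightarrow> s \<approx> p"
  unfolding weyl_cong_def using uminus_weyl_ideal[of "p - s"] by fastforce

lemma weyl_cong_trans [trans]: "p \<approx> s \<Longrightarrow> s \<approx> t \<Longrightarrow> p \<approx> t"
  unfolding weyl_cong_def using add_weyl_ideal[of "p - s" r n "s - t"] by simp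

lemma weyl_cong_mult:
  assumes "p \<approx> p'" "s \<approx> s'"
  shows "p * s \<approx> p' * s'"
proof -
  have "(p - p') * s + p' * (s - s') \<in> weyl_ideal r n"
    using assms unfolding weyl_cong_def
    by (intro add_weyl_ideal mult_left_weyl_ideal mult_right_weyl_ideal) auto
  then show ?thesis
    using assms by (simp add: weyl_cong_def mult_carrier algebra_simps)
qed

lemma weyl_cong_mult_left: "p \<approx> p' \<Longrightarrow> s \<in> carrier (free_alg r) \<Longrightarrow> s * p \<approx> s * p'"
  by (simp add: weyl_cong_mult weyl_cong_refl)

lemma weyl_cong_mult_right: "p \<approx> p' \<Longrightarrow> s \<in> carrier (free_alg r) \<Longrightarrow> p * s \<approx> p' * s"
  by (simp add: weyl_cong_mult weyl_cong_refl)

lemma weyl_cong_scal: "p \<approx> p' \<Longrightarrow> scal c * p \<approx> scal c * p'"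
  by (simp add: weyl_cong_mult_left scal_carrier)

lemma weyl_rel_cong: "weyl_rel r n p s \<Longrightarrow> p \<approx> s"
  by (auto simp: weyl_cong_def weyl_relD dest: weyl_rel_carrier)

lemma qcomm_carrier:
  assumes "qcomm r n c p s" shows "p \<in> carrier (free_alg r)" "s \<in> carrier (free_alg r)"
  using assms by (simp_all add: qcomm_def)

lemma qcommD: "qcomm r n c p s \<Longrightarrow> p * s \<approx> scal c * (s * p)"
  by (simp add: qcomm_def)

lemma qcomm_mult_right:
  assumes "qcomm r n c p s" "qcomm r n d p t"
  shows "qcomm r n (c * d) p (s * t)"
proof -
  note C = assms[THEN qcomm_carrier(1)] assms[THEN qcomm_carrier(2)]
  have "p * s * t \<approx> scal c * (s * p) * t"
    using assms C by (intro weyl_cong_mult_right qcommD)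
  also have "scal c * (s * p) * t = scal c * (s * (p * t))"
    by (simp add: mult.assoc)
  also have "\<dots> \<approx> scal c * (s * (scal d * (t * p)))"
    using assms C by (intro weyl_cong_scal weyl_cong_mult_left qcommD)
  finally show ?thesis
    using C by (simp add: qcomm_def mult_carrier mult.assoc scal_mult scal_left_commute[of s])
qed

lemma qcomm_mult_left:
  assumes "qcomm r n c s p" "qcomm r n d t p"
  shows "qcomm r n (c * d) (s * t) p"
proof -
  note C = assms[THEN qcomm_carrier(1)] assms[THEN qcomm_carrier(2)]
  have "s * (t * p) \<approx> s * (scal d * (p * t))"
    using assms C by (intro weyl_cong_mult_left qcommD)
  also have "s * (scal d * (p * t)) = scal d * ((s * p) * t)"
    by (simp add: mult.assoc scal_left_commute[of s])
  also have "\<dots> \<approx> scal d * (scal c * (p * s) * t)"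
    using assms C by (intro weyl_cong_scal weyl_cong_mult_right qcommD)
  finally show ?thesis
    using C by (simp add: qcomm_def mult_carrier mult.assoc scal_mult mult.commute[of c d])
qed

lemma qcomm_sym:
  assumes "qcomm r n c p s" "c \<noteq> 0"
  shows "qcomm r n (inverse c) s p"
proof -
  have "scal (inverse c) * (p * s) \<approx> scal (inverse c) * (scal c * (s * p))"
    using assms by (intro weyl_cong_scal qcommD)
  then show ?thesis
    using assms qcomm_carrier[OF assms(1)]
    by (simp add: qcomm_def mult.assoc[symmetric] scal_mult[symmetric] weyl_cong_sym)
qed

lemma qcomm_scal: "p \<in> carrier (free_alg r) \<Longrightarrow> qcomm r n 1 p (scal c)"
  by (simp add: qcomm_def scal_carrier scal_central mult_carrier weyl_cong_refl)

text \<open>Conjugating by \<open>t = s\<^sup>-\<^sup>1\<close>: from \<open>p s = c s p\<close> follows \<open>p t = t (s p) t = c\<^sup>-\<^sup>1 t (p s) t = c\<^sup>-\<^sup>1 t p\<close>. It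
supplies the commutation rules for the inverses of the torus generators, about which the
presentation says nothing beyond their being inverses.\<close>

lemma qcomm_inverse:
  assumes "qcomm r n c p s" "c \<noteq> 0" "s * t \<approx> 1" "t * s \<approx> 1" and t: "t \<in> carrier (free_alg r)"
  shows "qcomm r n (inverse c) p t"
proof -
  note C = qcomm_carrier[OF assms(1)] t
  have "1 * (p * t) \<approx> t * s * (p * t)"
    using C assms by (intro weyl_cong_mult_right weyl_cong_sym[OF assms(4)] mult_carrier)
  also have "t * s * (p * t) = t * (s * p) * t"
    by (simp add: mult.assoc)
  also have "\<dots> \<approx> t * (scal (inverse c) * (p * s)) * t"
    using C assms(1,2) by (intro weyl_cong_mult_right weyl_cong_mult_left qcommD qcomm_sym)
  also have "\<dots> = scal (inverse c) * (t * p * (s * t))"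
    by (simp add: mult.assoc scal_left_commute[of t])
  also have "\<dots> \<approx> scal (inverse c) * (t * p * 1)"
    using C assms by (intro weyl_cong_scal weyl_cong_mult_left mult_carrier)
  finally show ?thesis using C by (simp add: qcomm_def)
qed

lemma qcomm_power: "qcomm r n c p s \<Longrightarrow> qcomm r n (c ^ k) p (s ^ k)"
proof (induction k)
  case 0
  then show ?case using qcomm_scal[of p 1] qcomm_carrier by fastforce
next
  case (Suc k)
  then show ?case using qcomm_mult_right[of c p s "c ^ k" "s ^ k"] by simp
qed

lemma m_inverse:
  assumes "i \<in> {1..r + 1}" shows "mm i * mi i \<approx> 1" "mi i * mm i \<approx> 1"
  using weyl_rel.m_mi[OF assms] weyl_rel.mi_m[OF assms] by (simp_all only: weyl_rel_cong)

lemma mpow_carrier: "i \<in> {1..r + 1} \<Longrightarrow> mpow i k \<in> carrier (free_alg r)"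
  by (simp add: mpow_def carrier_intros)

lemma qcomm_mpow:
  assumes p: "qcomm r n c p (mm i)" and "c \<noteq> 0" and i: "i \<in> {1..r + 1}"
  shows "qcomm r n (c powi k) p (mpow i k)"
proof (cases "k \<ge> 0")
  case True
  then show ?thesis using qcomm_power[OF p, of "nat k"] by (simp add: mpow_def power_int_def)
next
  case False
  have "qcomm r n (inverse c) p (mi i)"
    using assms m_inverse[OF i] by (intro qcomm_inverse[of c p "mm i"]) (simp_all add: carrier_intros)
  from qcomm_power[OF this, of "nat (- k)"] show ?thesis
    using False by (simp add: mpow_def power_int_def)
qed

lemma power_mult_inverse_power:
  assumes "p * s \<approx> 1" and C: "p \<in> carrier (free_alg r)" "s \<in> carrier (free_alg r)"
  shows "p ^ k * s ^ k \<approx> 1"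
proof (induction k)
  case 0
  show ?case by (simp add: weyl_cong_refl one_carrier)
next
  case (Suc k)
  have "p ^ Suc k * s ^ Suc k = p ^ k * (p * s) * s ^ k"
    by (simp only: power_Suc2 power_Suc mult.assoc)
      (simp only: power_Suc[symmetric] power_Suc2 mult.assoc)
  also have "\<dots> \<approx> p ^ k * 1 * s ^ k"
    using assms by (intro weyl_cong_mult_left weyl_cong_mult_right power_carrier)
  also have "p ^ k * 1 * s ^ k \<approx> 1" using Suc.IH by simp
  finally show ?case .
qed

lemma mpow_mult_mpow_uminus:
  assumes "i \<in> {1..r + 1}" shows "mpow i k * mpow i (- k) \<approx> 1"
  using assms m_inverse[OF assms]
  by (auto simp: mpow_def carrier_intros weyl_cong_refl intro!: power_mult_inverse_power)

lemma qcomm_m_mpow: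
  assumes "i \<in> {1..r + 1}" "j \<in> {1..r + 1}" shows "qcomm r n 1 (mm i) (mpow j k)"
proof -
  have "qcomm r n 1 (mm i) (mm j)"
    using weyl_rel.m_m[OF assms] assms by (simp add: qcomm_def carrier_intros weyl_rel_cong)
  from qcomm_mpow[OF this _ assms(2), of k] show ?thesis by simp
qed

lemma qcomm_mpow_mpow:
  assumes "i \<in> {1..r + 1}" "j \<in> {1..r + 1}" shows "qcomm r n 1 (mpow i l) (mpow j k)"
proof -
  have "qcomm r n 1 (mpow i l) (mm j)"
    using qcomm_sym[OF qcomm_m_mpow[OF assms(2,1)]] by simp
  from qcomm_mpow[OF this _ assms(2), of k] show ?thesis by simp
qed

lemma qcomm_d_m:
  assumes "i \<in> {1..r + 1}" "j \<in> {1..r + 1}"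
  shows "qcomm r n (if i = j then q powi cc r n i else 1) (dd i) (mm j)"
  using assms weyl_rel.d_m[of i r j n] weyl_rel.d_m_same[of i r n]
  by (auto simp: qcomm_def carrier_intros mult.assoc weyl_rel_cong)

lemma qcomm_x_m:
  assumes "i \<in> {1..r + 1}" "j \<in> {1..r + 1}"
  shows "qcomm r n (if i = j then q powi (- cc r n i) else 1) (xx i) (mm j)"
  using assms weyl_rel.x_m[of i r j n] weyl_rel.x_m_same[of i r n]
  by (auto simp: qcomm_def carrier_intros mult.assoc weyl_rel_cong)

end

section \<open>Laurent monomials in the torus generators\<close>

text \<open>A Laurent monomial is kept as a list of exponents \<open>(k, a)\<close>, read as the product of the powers
\<open>m\<^sub>k\<^sup>a\<close> in this order, so that the images of the generators under the automorphisms are literally of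
the form \<open>torus_mon c u * g\<close>.\<close>

definition torus_mon :: "Qq \<Rightarrow> (nat \<times> int) list \<Rightarrow> falg" where
  "torus_mon c u = scal c * prod_list (map (\<lambda>(k, a). mpow k a) u)"

definition neg :: "(nat \<times> int) list \<Rightarrow> (nat \<times> int) list" where
  "neg u = map (\<lambda>(k, a). (k, - a)) u"

definition wt :: "(nat \<times> int) list \<Rightarrow> nat \<Rightarrow> int" where
  "wt u k = (\<Sum>(l, a)\<leftarrow>u. if l = k then a else 0)"

lemma wt_simps [simp]:
  "wt [] k = 0" "wt ((l, a) # u) k = (if l = k then a else 0) + wt u k"
  by (simp_all add: wt_def)

lemma neg_simps [simp]:
  "neg [] = []" "neg ((l, a) # u) = (l, - a) # neg u"
  by (simp_all add: neg_def)

lemma wt_neg [simp]: "wt (neg u) k = - wt u k"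
  by (induction u) auto

lemma fst_set_neg [simp]: "fst ` set (neg u) = fst ` set u"
  by (force simp: neg_def)

context
  fixes r n :: nat and u :: "(nat \<times> int) list"
  assumes u: "fst ` set u \<subseteq> {1..r + 1}"
begin

lemma torus_mon_carrier: "torus_mon c u \<in> carrier (free_alg r)"
  using u unfolding torus_mon_def
  by (intro mult_carrier scal_carrier prod_list_carrier) (auto simp: mpow_carrier)

text \<open>The case of interest is \<open>p = d\<^sub>i\<close> or \<open>p = x\<^sub>i\<close>, which commutes with every torus generator except the
\<open>i\<close>-th. Only the total exponent of \<open>m\<^sub>i\<close> then contributes a factor.\<close>

lemma qcomm_torus_mon:
  assumes p: "p \<in> carrier (free_alg r)"
    and m: "\<And>k a. k \<in> {1..r + 1} \<Longrightarrow> qcomm r n (if k = i then x powi a else 1) p (mpow k a)"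
    and x: "x \<noteq> 0"
  shows "qcomm r n (x powi wt u i) p (torus_mon c u)"
proof -
  have "qcomm r n (x powi wt u i) p (prod_list (map (\<lambda>(k, a). mpow k a) u))"
    using u
  proof (induction u)
    case Nil
    show ?case using qcomm_scal[OF p, of n 1] by simp
  next
    case (Cons ka u)
    obtain k a where ka: "ka = (k, a)" by force
    from Cons have "qcomm r n ((if k = i then x powi a else 1) * x powi wt u i) p
        (mpow k a * prod_list (map (\<lambda>(k, a). mpow k a) u))"
      by (intro qcomm_mult_right m) (auto simp: ka)
    moreover have "(if k = i then x powi a else 1) * x powi wt u i = x powi wt (ka # u) i"
      using x by (simp add: ka power_int_add)
    ultimately show ?case by (simp add: ka)
  qed
  from qcomm_mult_right[OF qcomm_scal[OF p, of n c] this] show ?thesis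
    by (simp add: torus_mon_def)
qed

lemma qcomm_d_torus_mon:
  assumes i: "i \<in> {1..r + 1}"
  shows "qcomm r n (q powi (cc r n i * wt u i)) (dd i) (torus_mon c u)"
proof -
  have "qcomm r n ((q powi cc r n i) powi wt u i) (dd i) (torus_mon c u)"
  proof (rule qcomm_torus_mon)
    fix k a assume k: "k \<in> {1..r + 1}"
    show "qcomm r n (if k = i then (q powi cc r n i) powi a else 1) (dd i) (mpow k a)"
      using qcomm_mpow[OF qcomm_d_m[OF i k, of n] _ k, of a] by (auto split: if_splits)
  qed (use i in \<open>simp_all add: carrier_intros\<close>)
  then show ?thesis by (simp only: power_int_mult)
qed

lemma qcomm_x_torus_mon:
  assumes i: "i \<in> {1..r + 1}"
  shows "qcomm r n (q powi (- cc r n i * wt u i)) (xx i) (torus_mon c u)"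
proof -
  have "qcomm r n ((q powi (- cc r n i)) powi wt u i) (xx i) (torus_mon c u)"
  proof (rule qcomm_torus_mon)
    fix k a assume k: "k \<in> {1..r + 1}"
    show "qcomm r n (if k = i then (q powi (- cc r n i)) powi a else 1) (xx i) (mpow k a)"
      using qcomm_mpow[OF qcomm_x_m[OF i k, of n] _ k, of a] by (auto split: if_splits)
  qed (use i in \<open>simp_all add: carrier_intros\<close>)
  then show ?thesis by (simp only: power_int_mult)
qed

lemma qcomm_1_torus_mon:
  assumes "p \<in> carrier (free_alg r)" "\<And>k a. k \<in> {1..r + 1} \<Longrightarrow> qcomm r n 1 p (mpow k a)"
  shows "qcomm r n 1 p (torus_mon c u)"
  using qcomm_torus_mon[of p _ 1 c] assms by simp

end

lemma qcomm_torus_mon_torus_mon: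
  assumes u: "fst ` set u \<subseteq> {1..r + 1}" and v: "fst ` set v \<subseteq> {1..r + 1}"
  shows "qcomm r n 1 (torus_mon c u) (torus_mon d v)"
proof (rule qcomm_1_torus_mon[OF v torus_mon_carrier[OF u]])
  fix k a assume k: "k \<in> {1..r + 1}"
  have "qcomm r n 1 (mpow k a) (torus_mon c u)"
    using k by (intro qcomm_1_torus_mon[OF u] mpow_carrier qcomm_mpow_mpow)
  from qcomm_sym[OF this] show "qcomm r n 1 (torus_mon c u) (mpow k a)" by simp
qed

text \<open>The factors of the two monomials cancel in pairs after the inner ones have been moved past each
other, since powers of torus generators commute.\<close>

lemma torus_mon_mult_neg:
  assumes u: "fst ` set u \<subseteq> {1..r + 1}"
  shows "weyl_cong r n (torus_mon c u * torus_mon d (neg u)) (scal (c * d))"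
proof -
  have "weyl_cong r n (torus_mon 1 u * torus_mon 1 (neg u)) 1"
    using u
  proof (induction u)
    case Nil
    show ?case by (simp add: torus_mon_def weyl_cong_refl one_carrier)
  next
    case (Cons ka u)
    obtain k a where ka: "ka = (k, a)" by force
    have k: "k \<in> {1..r + 1}" and u: "fst ` set u \<subseteq> {1..r + 1}"
      and nu: "fst ` set (neg u) \<subseteq> {1..r + 1}" using Cons.prems by (auto simp: ka)
    note C = torus_mon_carrier[OF u] torus_mon_carrier[OF nu] mpow_carrier[OF k]
    have "qcomm r n 1 (mpow k (- a)) (torus_mon 1 u)"
      using k by (intro qcomm_1_torus_mon[OF u] mpow_carrier qcomm_mpow_mpow)
    from qcommD[OF qcomm_sym[OF this]]
    have swap: "weyl_cong r n (torus_mon 1 u * mpow k (- a)) (mpow k (- a) * torus_mon 1 u)"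
      by simp
    have "torus_mon 1 (ka # u) * torus_mon 1 (neg (ka # u))
        = mpow k a * (torus_mon 1 u * mpow k (- a)) * torus_mon 1 (neg u)"
      by (simp add: torus_mon_def ka mult.assoc)
    also have "weyl_cong r n \<dots> (mpow k a * (mpow k (- a) * torus_mon 1 u) * torus_mon 1 (neg u))"
      by (intro weyl_cong_mult_left weyl_cong_mult_right swap C)
    also have "mpow k a * (mpow k (- a) * torus_mon 1 u) * torus_mon 1 (neg u)
        = (mpow k a * mpow k (- a)) * (torus_mon 1 u * torus_mon 1 (neg u))"
      by (simp add: mult.assoc)
    also have "weyl_cong r n \<dots> (1 * 1)"
      using Cons.IH[OF u] by (intro weyl_cong_mult mpow_mult_mpow_uminus k)
    finally show ?case by simp
  qed
  from weyl_cong_scal[OF this, of "c * d"] show ?thesis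
    by (simp add: torus_mon_def scal_mult mult.assoc scal_left_commute[of "prod_list _"])
qed

section \<open>Twisted substitutions respect the relations\<close>

text \<open>The common shape of all the automorphisms: an involution \<open>\<sigma>\<close> of the indices, with Laurent monomials
in front of the images of \<open>d\<^sub>j\<close> and \<open>x\<^sub>j\<close> whose exponents are opposite. Two numerical conditions are
what the relations require. Moving the monomials past the generators in the images of \<open>d\<^sub>j d\<^sub>k\<close>,
\<open>x\<^sub>j x\<^sub>k\<close> or \<open>d\<^sub>j x\<^sub>k\<close> with \<open>j \<noteq> k\<close> produces two powers of \<open>q\<close>, which cancel by the symmetry condition
\<open>wt_symmetric\<close>. In the image of \<open>d\<^sub>j x\<^sub>j\<close> or \<open>x\<^sub>j d\<^sub>j\<close> the monomials cancel and leave the scalar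
\<open>c\<^sub>j c'\<^sub>j\<close> together with one power of \<open>q\<close>; their product is \<open>1\<close> by \<open>coeff_normalized\<close>.\<close>

locale weyl_twist =
  fixes r n :: nat and \<sigma> :: "nat \<Rightarrow> nat" and c c' :: "nat \<Rightarrow> Qq"
    and u :: "nat \<Rightarrow> (nat \<times> int) list" and \<phi> :: "gen \<Rightarrow> falg"
  assumes \<sigma>_mem: "j \<in> {1..r + 1} \<Longrightarrow> \<sigma> j \<in> {1..r + 1}"
    and \<sigma>_\<sigma> [simp]: "\<sigma> (\<sigma> j) = j"
    and cc_\<sigma>: "j \<in> {1..r + 1} \<Longrightarrow> cc r n (\<sigma> j) = cc r n j"
    and u_mem: "j \<in> {1..r + 1} \<Longrightarrow> fst ` set (u j) \<subseteq> {1..r + 1}"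
    and \<phi>_D: "j \<in> {1..r + 1} \<Longrightarrow> \<phi> (D j) = torus_mon (c j) (u j) * dd (\<sigma> j)"
    and \<phi>_X: "j \<in> {1..r + 1} \<Longrightarrow> \<phi> (X j) = torus_mon (c' j) (neg (u j)) * xx (\<sigma> j)"
    and \<phi>_M: "j \<in> {1..r + 1} \<Longrightarrow> \<phi> (M j) = mm (\<sigma> j)"
    and \<phi>_Minv: "j \<in> {1..r + 1} \<Longrightarrow> \<phi> (Minv j) = mi (\<sigma> j)"
    and wt_symmetric: "\<lbrakk>j \<in> {1..r + 1}; k \<in> {1..r + 1}; j \<noteq> k\<rbrakk> \<Longrightarrow>
      cc r n j * wt (u k) (\<sigma> j) = cc r n k * wt (u j) (\<sigma> k)"
    and coeff_normalized: "j \<in> {1..r + 1} \<Longrightarrow> c j * c' j = q powi (cc r n j * wt (u j) (\<sigma> j))"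
begin

lemma \<sigma>_eq_iff [simp]: "\<sigma> i = \<sigma> j \<longleftrightarrow> i = j"
  by (metis \<sigma>_\<sigma>)

lemma neg_u: "j \<in> {1..r + 1} \<Longrightarrow> fst ` set (neg (u j)) \<subseteq> {1..r + 1}"
  using u_mem by simp

lemma gen_el_\<sigma>_carrier:
  assumes "j \<in> {1..r + 1}"
  shows "dd (\<sigma> j) \<in> carrier (free_alg r)" "xx (\<sigma> j) \<in> carrier (free_alg r)"
    "mm (\<sigma> j) \<in> carrier (free_alg r)" "mi (\<sigma> j) \<in> carrier (free_alg r)"
  using \<sigma>_mem[OF assms] by (simp_all add: carrier_intros)

lemma \<phi>_carrier: "g \<in> gens r \<Longrightarrow> \<phi> g \<in> carrier (free_alg r)"
  by (cases g) (simp_all del: atLeastAtMost_iff add: \<phi>_D \<phi>_X \<phi>_M \<phi>_Minv mult_carrier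
      torus_mon_carrier[OF u_mem] torus_mon_carrier[OF neg_u] gen_el_\<sigma>_carrier)

text \<open>The two cross factors are inverse to each other: one arises from moving \<open>p\<close> to the right past \<open>B\<close>,
the other from moving \<open>A\<close> to the right past \<open>s\<close>.\<close>

lemma qcomm_products:
  assumes "qcomm r n 1 A B" "qcomm r n b p B" "qcomm r n b s A" "b \<noteq> 0" "qcomm r n 1 p s"
  shows "weyl_cong r n (A * p * (B * s)) (B * s * (A * p))"
proof -
  have "qcomm r n (inverse b) A s" using assms by (simp add: qcomm_sym)
  then have "qcomm r n (1 * inverse b) A (B * s)" using assms by (intro qcomm_mult_right)
  moreover have "qcomm r n (b * 1) p (B * s)" using assms by (intro qcomm_mult_right)
  ultimately have "qcomm r n (1 * inverse b * (b * 1)) (A * p) (B * s)" by (rule qcomm_mult_left)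
  then show ?thesis using qcommD \<open>b \<noteq> 0\<close> by fastforce
qed

lemma qcomm_\<phi>_m:
  assumes "j \<in> {1..r + 1}" "fst ` set v \<subseteq> {1..r + 1}" "qcomm r n b p (mm (\<sigma> j))"
  shows "qcomm r n b (torus_mon a v * p) (mm (\<sigma> j))"
proof -
  have "qcomm r n 1 (mm (\<sigma> j)) (torus_mon a v)"
    using assms \<sigma>_mem by (intro qcomm_1_torus_mon gen_el_\<sigma>_carrier qcomm_m_mpow)
  from qcomm_mult_left[OF qcomm_sym[OF this] assms(3)] show ?thesis by simp
qed

text \<open>For the relations with \<open>q\<close>-commuting generators one compares the product of the cross factors on both
sides. In the images of \<open>d\<^sub>i x\<^sub>i\<close> and \<open>x\<^sub>i d\<^sub>i\<close> the inner Laurent monomial is moved to the left, where it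
meets its inverse up to a scalar; what remains is the relation at the index \<open>\<sigma> i\<close>.\<close>

lemma weyl_rel_\<phi>:
  assumes "weyl_rel r n a b"
  shows "weyl_cong r n (alg_hom \<phi> a) (alg_hom \<phi> b)"
  using assms
proof (induction rule: weyl_rel.induct)
  case (m_mi i)
  then show ?case
    using weyl_rel_cong[OF weyl_rel.m_mi[OF \<sigma>_mem]] by (simp add: alg_hom_mult \<phi>_M \<phi>_Minv)
next
  case (mi_m i)
  then show ?case
    using weyl_rel_cong[OF weyl_rel.mi_m[OF \<sigma>_mem]] by (simp add: alg_hom_mult \<phi>_M \<phi>_Minv)
next
  case (m_m i j)
  then show ?case
    using weyl_rel_cong[OF weyl_rel.m_m[OF \<sigma>_mem \<sigma>_mem]] by (simp add: alg_hom_mult \<phi>_M)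
next
  case (d_d i j)
  show ?case
  proof (cases "i = j")
    case True
    then show ?thesis
      using d_d \<phi>_carrier by (simp add: alg_hom_mult weyl_cong_refl mult_carrier)
  next
    case False
    \<comment> \<open>The two cross factors have the same exponent by the symmetry condition.\<close>
    have b: "qcomm r n (q powi (cc r n (\<sigma> i) * wt (u j) (\<sigma> i))) (dd (\<sigma> i)) (torus_mon (c j) (u j))"
      using d_d by (intro qcomm_d_torus_mon u_mem \<sigma>_mem)
    have "qcomm r n (q powi (cc r n (\<sigma> j) * wt (u i) (\<sigma> j))) (dd (\<sigma> j)) (torus_mon (c i) (u i))"
      using d_d by (intro qcomm_d_torus_mon u_mem \<sigma>_mem)
    moreover have "cc r n (\<sigma> j) * wt (u i) (\<sigma> j) = cc r n (\<sigma> i) * wt (u j) (\<sigma> i)"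
      using wt_symmetric[of i j] d_d False by (simp add: cc_\<sigma>)
    ultimately have b': "qcomm r n (q powi (cc r n (\<sigma> i) * wt (u j) (\<sigma> i))) (dd (\<sigma> j))
        (torus_mon (c i) (u i))" by simp
    have pq: "qcomm r n 1 (dd (\<sigma> i)) (dd (\<sigma> j))"
      using weyl_rel_cong[OF weyl_rel.d_d[OF d_d[THEN \<sigma>_mem]]] d_d
      by (simp del: atLeastAtMost_iff add: qcomm_def gen_el_\<sigma>_carrier)
    have "weyl_cong r n
        (torus_mon (c i) (u i) * dd (\<sigma> i) * (torus_mon (c j) (u j) * dd (\<sigma> j)))
        (torus_mon (c j) (u j) * dd (\<sigma> j) * (torus_mon (c i) (u i) * dd (\<sigma> i)))"
      using d_d by (intro qcomm_products[OF qcomm_torus_mon_torus_mon[OF u_mem u_mem] b b' q_powi_neq_0 pq])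
    then show ?thesis using d_d by (simp del: atLeastAtMost_iff add: alg_hom_mult \<phi>_D)
  qed
next
  case (x_x i j)
  show ?case
  proof (cases "i = j")
    case True
    then show ?thesis
      using x_x \<phi>_carrier by (simp add: alg_hom_mult weyl_cong_refl mult_carrier)
  next
    case False
    have b: "qcomm r n (q powi (- cc r n (\<sigma> i) * wt (neg (u j)) (\<sigma> i))) (xx (\<sigma> i))
        (torus_mon (c' j) (neg (u j)))"
      using x_x by (intro qcomm_x_torus_mon neg_u \<sigma>_mem)
    have "qcomm r n (q powi (- cc r n (\<sigma> j) * wt (neg (u i)) (\<sigma> j))) (xx (\<sigma> j))
        (torus_mon (c' i) (neg (u i)))"
      using x_x by (intro qcomm_x_torus_mon neg_u \<sigma>_mem)
    moreover have "- cc r n (\<sigma> j) * wt (neg (u i)) (\<sigma> j) = - cc r n (\<sigma> i) * wt (neg (u j)) (\<sigma> i)"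
      using wt_symmetric[of i j] x_x False by (simp add: cc_\<sigma>)
    ultimately have b': "qcomm r n (q powi (- cc r n (\<sigma> i) * wt (neg (u j)) (\<sigma> i))) (xx (\<sigma> j))
        (torus_mon (c' i) (neg (u i)))" by simp
    have pq: "qcomm r n 1 (xx (\<sigma> i)) (xx (\<sigma> j))"
      using weyl_rel_cong[OF weyl_rel.x_x[OF x_x[THEN \<sigma>_mem]]] x_x
      by (simp del: atLeastAtMost_iff add: qcomm_def gen_el_\<sigma>_carrier)
    have "weyl_cong r n
        (torus_mon (c' i) (neg (u i)) * xx (\<sigma> i) * (torus_mon (c' j) (neg (u j)) * xx (\<sigma> j)))
        (torus_mon (c' j) (neg (u j)) * xx (\<sigma> j) * (torus_mon (c' i) (neg (u i)) * xx (\<sigma> i)))"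
      using x_x by (intro qcomm_products[OF qcomm_torus_mon_torus_mon[OF neg_u neg_u] b b' q_powi_neq_0 pq])
    then show ?thesis using x_x by (simp del: atLeastAtMost_iff add: alg_hom_mult \<phi>_X)
  qed
next
  case (d_x i j)
  have b: "qcomm r n (q powi (cc r n (\<sigma> i) * wt (neg (u j)) (\<sigma> i))) (dd (\<sigma> i))
      (torus_mon (c' j) (neg (u j)))"
    using d_x by (intro qcomm_d_torus_mon neg_u \<sigma>_mem)
  have "qcomm r n (q powi (- cc r n (\<sigma> j) * wt (u i) (\<sigma> j))) (xx (\<sigma> j)) (torus_mon (c i) (u i))"
    using d_x by (intro qcomm_x_torus_mon u_mem \<sigma>_mem)
  moreover have "- cc r n (\<sigma> j) * wt (u i) (\<sigma> j) = cc r n (\<sigma> i) * wt (neg (u j)) (\<sigma> i)"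
    using wt_symmetric[of i j] d_x by (simp add: cc_\<sigma>)
  ultimately have b': "qcomm r n (q powi (cc r n (\<sigma> i) * wt (neg (u j)) (\<sigma> i))) (xx (\<sigma> j))
      (torus_mon (c i) (u i))" by simp
  have pq: "qcomm r n 1 (dd (\<sigma> i)) (xx (\<sigma> j))"
    using weyl_rel_cong[OF weyl_rel.d_x[OF d_x(1,2)[THEN \<sigma>_mem]]] d_x
    by (simp del: atLeastAtMost_iff add: qcomm_def gen_el_\<sigma>_carrier)
  have "weyl_cong r n
      (torus_mon (c i) (u i) * dd (\<sigma> i) * (torus_mon (c' j) (neg (u j)) * xx (\<sigma> j)))
      (torus_mon (c' j) (neg (u j)) * xx (\<sigma> j) * (torus_mon (c i) (u i) * dd (\<sigma> i)))"
    using d_x by (intro qcomm_products[OF qcomm_torus_mon_torus_mon[OF u_mem neg_u] b b' q_powi_neq_0 pq])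
  then show ?case using d_x by (simp del: atLeastAtMost_iff add: alg_hom_mult \<phi>_D \<phi>_X)
next
  case (d_m i j)
  have "qcomm r n 1 (dd (\<sigma> i)) (mm (\<sigma> j))"
    using qcomm_d_m[OF d_m(1,2)[THEN \<sigma>_mem], of n] d_m by simp
  then have "qcomm r n 1 (torus_mon (c i) (u i) * dd (\<sigma> i)) (mm (\<sigma> j))"
    using d_m by (intro qcomm_\<phi>_m u_mem)
  then show ?case
    using qcommD d_m by (fastforce simp: alg_hom_mult \<phi>_D \<phi>_M simp del: atLeastAtMost_iff)
next
  case (x_m i j)
  have "qcomm r n 1 (xx (\<sigma> i)) (mm (\<sigma> j))"
    using qcomm_x_m[OF x_m(1,2)[THEN \<sigma>_mem], of n] x_m by simp
  then have "qcomm r n 1 (torus_mon (c' i) (neg (u i)) * xx (\<sigma> i)) (mm (\<sigma> j))"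
    using x_m by (intro qcomm_\<phi>_m neg_u)
  then show ?case
    using qcommD x_m by (fastforce simp: alg_hom_mult \<phi>_X \<phi>_M simp del: atLeastAtMost_iff)
next
  case (d_m_same i)
  have "qcomm r n (q powi cc r n i) (dd (\<sigma> i)) (mm (\<sigma> i))"
    using qcomm_d_m[OF d_m_same[THEN \<sigma>_mem] d_m_same[THEN \<sigma>_mem], of n] d_m_same
    by (simp add: cc_\<sigma>)
  then have "qcomm r n (q powi cc r n i) (torus_mon (c i) (u i) * dd (\<sigma> i)) (mm (\<sigma> i))"
    using d_m_same by (intro qcomm_\<phi>_m u_mem)
  from qcommD[OF this] show ?case
    using d_m_same by (simp add: alg_hom_mult \<phi>_D \<phi>_M mult.assoc del: atLeastAtMost_iff)
next
  case (x_m_same i)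
  have "qcomm r n (q powi (- cc r n i)) (xx (\<sigma> i)) (mm (\<sigma> i))"
    using qcomm_x_m[OF x_m_same[THEN \<sigma>_mem] x_m_same[THEN \<sigma>_mem], of n] x_m_same
    by (simp add: cc_\<sigma>)
  then have "qcomm r n (q powi (- cc r n i)) (torus_mon (c' i) (neg (u i)) * xx (\<sigma> i)) (mm (\<sigma> i))"
    using x_m_same by (intro qcomm_\<phi>_m neg_u)
  from qcommD[OF this] show ?case
    using x_m_same by (simp add: alg_hom_mult \<phi>_X \<phi>_M mult.assoc del: atLeastAtMost_iff)
next
  case (d_x_same i)
  let ?A = "torus_mon (c i) (u i)" and ?B = "torus_mon (c' i) (neg (u i))"
  let ?b = "q powi (cc r n (\<sigma> i) * wt (neg (u i)) (\<sigma> i))"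
  note C = torus_mon_carrier[OF u_mem[OF d_x_same]] torus_mon_carrier[OF neg_u[OF d_x_same]]
    gen_el_\<sigma>_carrier[OF d_x_same]
  have "qcomm r n ?b (dd (\<sigma> i)) ?B"
    using d_x_same by (intro qcomm_d_torus_mon neg_u \<sigma>_mem)
  then have "weyl_cong r n (?A * (dd (\<sigma> i) * ?B) * xx (\<sigma> i)) (?A * (scal ?b * (?B * dd (\<sigma> i))) * xx (\<sigma> i))"
    by (intro weyl_cong_mult_left weyl_cong_mult_right qcommD C)
  also have "?A * (scal ?b * (?B * dd (\<sigma> i))) * xx (\<sigma> i) = scal ?b * (?A * ?B * (dd (\<sigma> i) * xx (\<sigma> i)))"
    by (simp add: mult.assoc scal_left_commute[of ?A])
  also have "weyl_cong r n \<dots> (scal ?b * (scal (c i * c' i) * (dd (\<sigma> i) * xx (\<sigma> i))))"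
    by (intro weyl_cong_scal weyl_cong_mult_right torus_mon_mult_neg u_mem d_x_same mult_carrier C)
  also have "\<dots> = scal (?b * (c i * c' i)) * (dd (\<sigma> i) * xx (\<sigma> i))"
    by (simp add: scal_mult mult.assoc)
  also have "?b * (c i * c' i) = 1"
    using d_x_same by (simp add: coeff_normalized cc_\<sigma> power_int_minus)
  also have "scal 1 * (dd (\<sigma> i) * xx (\<sigma> i)) = dd (\<sigma> i) * xx (\<sigma> i)"
    by simp
  finally show ?case
    using weyl_cong_trans[OF _ weyl_rel_cong[OF weyl_rel.d_x_same[OF \<sigma>_mem[OF d_x_same], of n]]] d_x_same
    by (simp add: alg_hom_mult alg_hom_diff \<phi>_D \<phi>_X \<phi>_M \<phi>_Minv cc_\<sigma> mult.assoc
        del: atLeastAtMost_iff)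
next
  case (x_d_same i)
  let ?A = "torus_mon (c i) (u i)" and ?B = "torus_mon (c' i) (neg (u i))"
  let ?b = "q powi (- cc r n (\<sigma> i) * wt (u i) (\<sigma> i))"
  note C = torus_mon_carrier[OF u_mem[OF x_d_same]] torus_mon_carrier[OF neg_u[OF x_d_same]]
    gen_el_\<sigma>_carrier[OF x_d_same]
  have BA: "weyl_cong r n (?B * ?A) (scal (c i * c' i))"
    using weyl_cong_trans[OF qcommD[OF qcomm_torus_mon_torus_mon[OF neg_u u_mem]]] x_d_same
      torus_mon_mult_neg[OF u_mem] by simp
  have "qcomm r n ?b (xx (\<sigma> i)) ?A"
    using x_d_same by (intro qcomm_x_torus_mon u_mem \<sigma>_mem)
  then have "weyl_cong r n (?B * (xx (\<sigma> i) * ?A) * dd (\<sigma> i)) (?B * (scal ?b * (?A * xx (\<sigma> i))) * dd (\<sigma> i))"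
    by (intro weyl_cong_mult_left weyl_cong_mult_right qcommD C)
  also have "?B * (scal ?b * (?A * xx (\<sigma> i))) * dd (\<sigma> i) = scal ?b * (?B * ?A * (xx (\<sigma> i) * dd (\<sigma> i)))"
    by (simp add: mult.assoc scal_left_commute[of ?B])
  also have "weyl_cong r n \<dots> (scal ?b * (scal (c i * c' i) * (xx (\<sigma> i) * dd (\<sigma> i))))"
    by (intro weyl_cong_scal weyl_cong_mult_right BA mult_carrier C)
  also have "\<dots> = scal (?b * (c i * c' i)) * (xx (\<sigma> i) * dd (\<sigma> i))"
    by (simp add: scal_mult mult.assoc)
  also have "?b * (c i * c' i) = 1"
    using x_d_same by (simp add: coeff_normalized cc_\<sigma> power_int_minus)
  also have "scal 1 * (xx (\<sigma> i) * dd (\<sigma> i)) = xx (\<sigma> i) * dd (\<sigma> i)"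
    by simp
  finally show ?case
    using weyl_cong_trans[OF _ weyl_rel_cong[OF weyl_rel.x_d_same[OF \<sigma>_mem[OF x_d_same], of n]]] x_d_same
    by (simp add: alg_hom_mult alg_hom_diff \<phi>_D \<phi>_X \<phi>_M \<phi>_Minv mult.assoc
        del: atLeastAtMost_iff)
qed

lemma induced_\<phi>_coset:
  assumes "p \<in> carrier (free_alg r)"
  shows "induced r n \<phi> (weyl_ideal r n +>\<^bsub>free_alg r\<^esub> p)
    = weyl_ideal r n +>\<^bsub>free_alg r\<^esub> alg_hom \<phi> p"
  using assms weyl_rel_\<phi> by (intro induced_coset \<phi>_carrier) (simp_all add: weyl_cong_def)

end

section \<open>Twisted monomial operators intertwine the action\<close>

text \<open>The eigenvalue of \<open>torus_mon c u\<close> on the monomial with exponent vector \<open>a\<close> is \<open>c\<close> times \<open>q\<close> to this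
power.\<close>

definition torus_exponent :: "nat \<Rightarrow> nat \<Rightarrow> (nat \<times> int) list \<Rightarrow> expo \<Rightarrow> int" where
  "torus_exponent r n u a = (\<Sum>(k, x)\<leftarrow>u. cc r n k * x * int (Poly_Mapping.lookup a k))"

lemma torus_exponent_simps [simp]:
  "torus_exponent r n [] a = 0"
  "torus_exponent r n ((k, x) # u) a
    = cc r n k * x * int (Poly_Mapping.lookup a k) + torus_exponent r n u a"
  by (simp_all add: torus_exponent_def)

lemma torus_exponent_neg [simp]: "torus_exponent r n (neg u) a = - torus_exponent r n u a"
  by (induction u) auto

lemma torus_exponent_add_single:
  "torus_exponent r n u (a + Poly_Mapping.single k 1) = torus_exponent r n u a + cc r n k * wt u k"
  by (induction u) (auto simp: lookup_add lookup_single algebra_simps when_def)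

lemma free_act_mpow:
  "free_act r n (mpow k x) (mon a y)
    = mon a (q powi (cc r n k * x * int (Poly_Mapping.lookup a k)) * y)"
proof -
  have power: "free_act r n (p ^ j) (mon a y) = mon a (q powi (int j * w) * y)"
    if "\<And>y. free_act r n p (mon a y) = mon a (q powi w * y)" for p j w
    by (induction j) (simp_all add: that free_act_mult power_int_add distrib_right mult.assoc)
  have "free_act r n (mm k) (mon a y) = mon a (q powi (cc r n k * int (Poly_Mapping.lookup a k)) * y)" for y
    by (simp add: mult.commute[of y])
  note m = power[OF this, of "nat x"]
  have "free_act r n (mi k) (mon a y) = mon a (q powi (- cc r n k * int (Poly_Mapping.lookup a k)) * y)" for y
    by (simp add: mult.commute[of y])
  note mi = power[OF this, of "nat (- x)"]
  show ?thesis
    using m mi by (simp add: mpow_def algebra_simps)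
qed

lemma free_act_torus_mon:
  "free_act r n (torus_mon c u) (mon a y) = mon a (c * q powi torus_exponent r n u a * y)"
proof -
  have "free_act r n (prod_list (map (\<lambda>(k, x). mpow k x) u)) (mon a y)
      = mon a (q powi torus_exponent r n u a * y)"
    by (induction u) (auto simp: free_act_mult free_act_mpow power_int_add mult.assoc)
  then show ?thesis by (simp add: torus_mon_def free_act_mult mult.assoc)
qed

lemma free_act_sum: "free_act r n (sum g S) f = (\<Sum>x\<in>S. free_act r n (g x) f)"
  by (induction S rule: infinite_finite_induct) (simp_all add: free_act_add)

lemma lin_ext_sum: "lin_ext \<phi> (sum g S) = (\<Sum>x\<in>S. lin_ext \<phi> (g x))"
  by (induction S rule: infinite_finite_induct) (simp_all add: lin_ext_add)

text \<open>For an involution \<open>\<sigma>\<close> this is the operator \<open>X\<^sup>a \<mapsto> \<kappa>(a) X\<^bsup>\<sigma> a\<^esup>\<close>; with \<open>\<sigma> = id\<close> it is diagonal.\<close>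

definition twist :: "(nat \<Rightarrow> nat) \<Rightarrow> (expo \<Rightarrow> Qq) \<Rightarrow> pols \<Rightarrow> pols" where
  "twist \<sigma> \<kappa> = lin_ext (\<lambda>a. mon (Poly_Mapping.map_key \<sigma> a) (\<kappa> a))"

lemma twist_mon [simp]: "twist \<sigma> \<kappa> (mon a y) = mon (Poly_Mapping.map_key \<sigma> a) (y * \<kappa> a)"
  by (simp add: twist_def)

text \<open>The recursion \<open>\<kappa>_step\<close> is the intertwining relation for \<open>x\<^sub>j\<close>, evaluated on a monomial: the power of
\<open>q\<close> is the eigenvalue of the Laurent monomial in the image of \<open>x\<^sub>j\<close>.\<close>

locale weyl_twist_operator = weyl_twist +
  fixes \<kappa> :: "expo \<Rightarrow> Qq"
  assumes \<kappa>_step: "j \<in> {1..r + 1} \<Longrightarrow> \<kappa> (a + Poly_Mapping.single j 1) =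
    c' j * q powi (- torus_exponent r n (u j)
      (Poly_Mapping.map_key \<sigma> (a + Poly_Mapping.single j 1))) * \<kappa> a"
begin

lemma inj_\<sigma>: "inj \<sigma>"
  by (metis injI \<sigma>_\<sigma>)

lemma lookup_map_key_\<sigma> [simp]:
  "Poly_Mapping.lookup (Poly_Mapping.map_key \<sigma> a) i = Poly_Mapping.lookup a (\<sigma> i)"
  using inj_\<sigma> by (simp add: map_key.rep_eq)

lemma map_key_add_single:
  "Poly_Mapping.map_key \<sigma> (a + Poly_Mapping.single j 1)
    = Poly_Mapping.map_key \<sigma> a + Poly_Mapping.single (\<sigma> j) (1 :: nat)"
  by (simp only: map_key_plus[OF inj_\<sigma>] map_key_single[OF inj_\<sigma>, of "\<sigma> j", unfolded \<sigma>_\<sigma>])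

text \<open>For \<open>x\<^sub>j\<close> the claim is \<open>\<kappa>_step\<close>, and for \<open>m\<^sub>j\<close> it holds because \<open>\<sigma>\<close> preserves the numbers \<open>c\<^sub>j\<close>. For
\<open>d\<^sub>j\<close> there is no further condition: \<open>\<kappa>_step\<close> read backwards, from \<open>a\<close> to \<open>b = a - e\<^sub>j\<close>, gives the right
scalar because of \<open>coeff_normalized\<close>.\<close>

lemma twist_gen:
  assumes "g \<in> gens r"
  shows "twist \<sigma> \<kappa> (lin_ext (gen_mon r n g) f) = free_act r n (\<phi> g) (twist \<sigma> \<kappa> f)"
proof (rule additive_eq_if_eq_on_singles[of "\<lambda>f. twist \<sigma> \<kappa> (lin_ext (gen_mon r n g) f)"])
  fix a y
  show "twist \<sigma> \<kappa> (lin_ext (gen_mon r n g) (mon a y)) = free_act r n (\<phi> g) (twist \<sigma> \<kappa> (mon a y))"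
  proof (cases g)
    case (X j)
    then have j: "j \<in> {1..r + 1}" using assms by simp
    show ?thesis
      using j by (simp del: One_nat_def add: X \<phi>_X free_act_mult free_act_torus_mon \<kappa>_step
          map_key_add_single mult_ac)
  next
    case (D j)
    then have j: "j \<in> {1..r + 1}" using assms by simp
    show ?thesis
    proof (cases "Poly_Mapping.lookup a j")
      case 0
      then show ?thesis using j by (simp add: D \<phi>_D free_act_mult twist_def)
    next
      case (Suc k)
      define b where "b = a - Poly_Mapping.single j 1"
      have a: "a = b + Poly_Mapping.single j 1"
        using Suc expo_minus_plus[of a j] by (simp add: b_def)
      let ?b = "Poly_Mapping.map_key \<sigma> b"
      let ?x = "q powi torus_exponent r n (u j) ?b"
      let ?w = "q powi (cc r n j * wt (u j) (\<sigma> j))"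
      \<comment> \<open>\<open>?w\<close> is the change of the torus eigenvalue caused by the letter that \<open>d\<^sub>j\<close> removes.\<close>
      have "\<kappa> a = c' j * inverse (?x * ?w) * \<kappa> b"
        using j by (simp del: One_nat_def add: a \<kappa>_step map_key_add_single
            torus_exponent_add_single cc_\<sigma> power_int_minus power_int_diff divide_inverse)
      then have "c j * ?x * \<kappa> a = (c j * c' j) * inverse ?w * \<kappa> b"
        by (simp add: field_simps)
      then have *: "c j * ?x * \<kappa> a = \<kappa> b"
        by (simp only: coeff_normalized[OF j]) simp
      have "twist \<sigma> \<kappa> (lin_ext (gen_mon r n g) (mon a y))
          = mon ?b (y * qint (cc r n j * int (Poly_Mapping.lookup a j)) * \<kappa> b)"
        using Suc by (simp add: D b_def mult.commute)
      also have "\<dots> = free_act r n (\<phi> g) (twist \<sigma> \<kappa> (mon a y))"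
        using j Suc
        by (simp del: One_nat_def add: D \<phi>_D free_act_mult free_act_torus_mon cc_\<sigma> *[symmetric])
          (simp del: One_nat_def add: a map_key_add_single mult_ac lookup_add)
      finally show ?thesis .
    qed
  qed (use assms in \<open>simp_all add: \<phi>_M \<phi>_Minv cc_\<sigma> mult_ac\<close>)
qed (simp_all add: twist_def lin_ext_add free_act_add_right)

lemma twist_word:
  assumes "set w \<subseteq> gens r"
  shows "twist \<sigma> \<kappa> (foldr (\<lambda>g. lin_ext (gen_mon r n g)) w f)
    = free_act r n (prod_list (map \<phi> w)) (twist \<sigma> \<kappa> f)"
  using assms by (induction w) (simp_all add: twist_gen free_act_mult)

lemma twist_free_act:
  assumes "p \<in> carrier (free_alg r)"
  shows "twist \<sigma> \<kappa> (free_act r n p f) = free_act r n (alg_hom \<phi> p) (twist \<sigma> \<kappa> f)"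
proof -
  have "twist \<sigma> \<kappa> (free_act r n p f) = (\<Sum>w \<in> Poly_Mapping.keys p.
      scal (Poly_Mapping.lookup p w) * twist \<sigma> \<kappa> (foldr (\<lambda>g. lin_ext (gen_mon r n g)) (letters w) f))"
    by (simp add: free_act_def lin_ext_def[of _ p] twist_def lin_ext_sum lin_ext_scal)
  also have "\<dots> = (\<Sum>w \<in> Poly_Mapping.keys p. scal (Poly_Mapping.lookup p w) *
      free_act r n (prod_list (map \<phi> (letters w))) (twist \<sigma> \<kappa> f))"
    using assms by (intro sum.cong) (simp_all add: twist_word carrier_free_alg_iff)
  also have "\<dots> = free_act r n (alg_hom \<phi> p) (twist \<sigma> \<kappa> f)"
    by (simp add: alg_hom_def lin_ext_def[of _ p] free_act_sum free_act_mult)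
  finally show ?thesis .
qed

lemma twist_act:
  assumes "A \<in> carrier (Aq r n)"
  shows "twist \<sigma> \<kappa> (act r n A f) = act r n (induced r n \<phi> A) (twist \<sigma> \<kappa> f)"
proof -
  obtain p where p: "p \<in> carrier (free_alg r)" "A = weyl_ideal r n +>\<^bsub>free_alg r\<^esub> p"
    using assms by (rule Aq_carrierE)
  then show ?thesis
    using alg_hom_carrier[OF \<phi>_carrier] by (simp add: induced_\<phi>_coset act_coset twist_free_act)
qed

end

section \<open>The three kinds of twists\<close>

lemma lookup_map_key_transpose [simp]:
  "Poly_Mapping.lookup (Poly_Mapping.map_key (transpose i j) a) k
    = Poly_Mapping.lookup a (transpose i j k)"
  by (simp add: map_key.rep_eq)

text \<open>Both families of automorphisms that exchange two neighbouring indices are obtained from this one: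
the first has \<open>\<gamma> = 1\<close>, \<open>\<delta> = - q\<^bsup>-e\<^esup>\<close>, \<open>\<epsilon> = - e\<close>, the second \<open>\<gamma> = - q\<^sup>e\<close>, \<open>\<delta> = 1\<close>, \<open>\<epsilon> = e\<close>. The
hypothesis \<open>c\<^sub>i\<^sub>+\<^sub>1 = 1\<close> ensures that the two indices carry the same parameter.\<close>

lemma weyl_twist_operator_swap:
  fixes \<gamma> \<delta> :: Qq and \<epsilon> :: int
  assumes i: "i \<in> {1..r}" "cc r n (i + 1) = 1" and nz: "\<gamma> \<noteq> 0" "\<delta> \<noteq> 0"
  defines "c \<equiv> \<lambda>j. if j = i then \<gamma> else if j = i + 1 then \<delta> else 1"
    and "c' \<equiv> \<lambda>j. if j = i then inverse \<gamma> else if j = i + 1 then inverse \<delta> else 1"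
    and "u \<equiv> \<lambda>j. if j = i \<or> j = i + 1 then [(j, \<epsilon>)] else []"
  assumes D: "\<And>j. \<phi> (D j) = torus_mon (c j) (u j) * dd (transpose i (i + 1) j)"
    and X: "\<And>j. \<phi> (X j) = torus_mon (c' j) (neg (u j)) * xx (transpose i (i + 1) j)"
    and M: "\<And>j. \<phi> (M j) = mm (transpose i (i + 1) j)"
    and Minv: "\<And>j. \<phi> (Minv j) = mi (transpose i (i + 1) j)"
    and \<kappa>: "\<And>a. \<kappa> a = inverse \<gamma> ^ Poly_Mapping.lookup a i * inverse \<delta> ^ Poly_Mapping.lookup a (i + 1) *
      q powi (- \<epsilon> * int (Poly_Mapping.lookup a i) * int (Poly_Mapping.lookup a (i + 1)))"
  shows "weyl_twist_operator r n (transpose i (i + 1)) c c' u \<phi> \<kappa>"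
proof unfold_locales
  have cc: "cc r n i = 1" using i by (simp add: cc_def)
  show "transpose i (i + 1) j \<in> {1..r + 1}" if "j \<in> {1..r + 1}" for j
    using that i by (auto simp: transpose_def)
  show "cc r n (transpose i (i + 1) j) = cc r n j" for j
    using i cc by (auto simp: transpose_def)
  show "fst ` set (u j) \<subseteq> {1..r + 1}" if "j \<in> {1..r + 1}" for j
    using that by (auto simp: u_def)
  show "cc r n j * wt (u k) (transpose i (i + 1) j) = cc r n k * wt (u j) (transpose i (i + 1) k)"
    if "j \<noteq> k" for j k
    using that i cc by (auto simp: u_def transpose_def)
  show "c j * c' j = q powi (cc r n j * wt (u j) (transpose i (i + 1) j))" for j
    using nz by (auto simp: c_def c'_def u_def transpose_def)
  show "\<kappa> (a + Poly_Mapping.single j 1) = c' j * q powi (- torus_exponent r n (u j)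
      (Poly_Mapping.map_key (transpose i (i + 1)) (a + Poly_Mapping.single j 1))) * \<kappa> a" for j a
    using i cc by (auto simp: \<kappa> c'_def u_def lookup_add lookup_single when_def power_int_diff
        power_int_add power_int_minus field_simps)
qed (simp_all add: D X M Minv)

text \<open>The quadratic exponent of \<open>\<kappa>\<close> integrates the recursion: replacing \<open>x\<close> by \<open>x + 1\<close> in
\<open>(x\<^sup>2 + 3 x) / 2\<close> adds \<open>x + 2\<close>, and the mixed term \<open>2 x y\<close> is symmetric in the two variables because
\<open>c\<^sub>r\<^sub>+\<^sub>1 = 2\<close> compensates for the different exponents of \<open>m\<^sub>r\<close> and \<open>m\<^sub>r\<^sub>+\<^sub>1\<close>.\<close>

lemma weyl_twist_operator_diag_even:
  fixes r n :: nat and e :: int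
  assumes r: "r \<ge> 1" and n: "n = 2 * r"
  defines "c \<equiv> \<lambda>j. if j = r + 1 then q powi e else if j = r then q powi (- 2 * e) else 1"
    and "c' \<equiv> \<lambda>j. if j = r + 1 then q powi (- e) else if j = r then q powi e else 1"
    and "u \<equiv> \<lambda>j. if j = r + 1 then [(r, - 2 * e)] else if j = r then [(r, - e), (r + 1, - e)] else []"
    and "\<kappa> \<equiv> \<lambda>a. let x = int (Poly_Mapping.lookup a r); y = int (Poly_Mapping.lookup a (r + 1)) in
      q powi (e * ((x\<^sup>2 + 3 * x) div 2) - e * y + 2 * e * x * y)"
  shows "weyl_twist_operator r n (\<lambda>j. j) c c' u (Tp_gen r n e r) \<kappa>"
proof unfold_locales
  have N: "\<not> r < NN n" using n by simp
  have cc: "cc r n r = 1" "cc r n (r + 1) = 2" using n by (simp_all add: cc_def)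
  show "fst ` set (u j) \<subseteq> {1..r + 1}" if "j \<in> {1..r + 1}" for j
    using that r by (auto simp: u_def)
  show "cc r n j * wt (u k) j = cc r n k * wt (u j) k" if "j \<noteq> k" for j k
    using that cc by (auto simp: u_def)
  show "c j * c' j = q powi (cc r n j * wt (u j) j)" for j
    using cc by (auto simp: c_def c'_def u_def power_int_add[symmetric])
  show "\<kappa> (a + Poly_Mapping.single j 1) = c' j * q powi (- torus_exponent r n (u j)
      (Poly_Mapping.map_key (\<lambda>j. j) (a + Poly_Mapping.single j 1))) * \<kappa> a" for j a
  proof -
    let ?x = "int (Poly_Mapping.lookup a r)"
    \<comment> \<open>The numerator changes by a multiple of \<open>2\<close>, so the increment passes through \<open>div\<close>.\<close>
    have "(?x + 1)\<^sup>2 + 3 * (?x + 1) = ?x\<^sup>2 + 3 * ?x + (?x + 2) * 2"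
      by (simp add: power2_eq_square algebra_simps)
    then have "((?x + 1)\<^sup>2 + 3 * (?x + 1)) div 2 = (?x\<^sup>2 + 3 * ?x) div 2 + (?x + 2)"
      by (simp only: div_mult_self1)
    then show ?thesis
      using cc by (auto simp: \<kappa>_def Let_def c'_def u_def map_key_id lookup_add lookup_single when_def
          power_int_add[symmetric] add.commute[of 1] simp del: power_int_add) (auto simp: algebra_simps)
  qed
  show "Tp_gen r n e r (D j) = torus_mon (c j) (u j) * dd j" for j
    using n N by (auto simp: Tp_gen_def torus_mon_def c_def u_def mult.assoc)
  show "Tp_gen r n e r (X j) = torus_mon (c' j) (neg (u j)) * xx j" for j
    using n N by (auto simp: Tp_gen_def torus_mon_def c'_def u_def mult.assoc)
  show "Tp_gen r n e r (M j) = mm j" "Tp_gen r n e r (Minv j) = mi j" for j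
    using n N by (simp_all add: Tp_gen_def)
qed simp_all

text \<open>Replacing \<open>x\<close> by \<open>x + 1\<close> in \<open>(x\<^sup>2 - x) / 2\<close> adds \<open>x\<close>; the recursion asks for \<open>x + 1\<close> from the torus
generator, evaluated after raising the exponent, minus \<open>1\<close> from the scalar \<open>q\<^bsup>-e\<^esup>\<close>, all of it
multiplied by \<open>e\<close>.\<close>

lemma weyl_twist_operator_diag_odd:
  fixes r n :: nat and e :: int
  assumes n: "n = 2 * r + 1"
  defines "c \<equiv> \<lambda>j::nat. 1"
    and "c' \<equiv> \<lambda>j. if j = r + 1 then q powi (- e) else 1"
    and "u \<equiv> \<lambda>j. if j = r + 1 then [(r + 1, - e)] else []"
    and "\<kappa> \<equiv> \<lambda>a. let x = int (Poly_Mapping.lookup a (r + 1)) in q powi (e * ((x\<^sup>2 - x) div 2))"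
  shows "weyl_twist_operator r n (\<lambda>j. j) c c' u (Tp_gen r n e (r + 1)) \<kappa>"
proof unfold_locales
  have N: "\<not> r + 1 < NN n" using n by simp
  have cc: "cc r n j = 1" for j using n by (simp add: cc_def)
  show "fst ` set (u j) \<subseteq> {1..r + 1}" for j
    by (auto simp: u_def)
  show "cc r n j * wt (u k) j = cc r n k * wt (u j) k" if "j \<noteq> k" for j k
    using that cc by (auto simp: u_def)
  show "c j * c' j = q powi (cc r n j * wt (u j) j)" for j
    using cc by (auto simp: c_def c'_def u_def)
  show "\<kappa> (a + Poly_Mapping.single j 1) = c' j * q powi (- torus_exponent r n (u j)
      (Poly_Mapping.map_key (\<lambda>j. j) (a + Poly_Mapping.single j 1))) * \<kappa> a" for j a
  proof -
    let ?x = "int (Poly_Mapping.lookup a (r + 1))"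
    \<comment> \<open>Again the numerator changes by a multiple of \<open>2\<close>.\<close>
    have "(?x + 1)\<^sup>2 - (?x + 1) = ?x\<^sup>2 - ?x + ?x * 2"
      by (simp add: power2_eq_square algebra_simps)
    then have "((?x + 1)\<^sup>2 - (?x + 1)) div 2 = (?x\<^sup>2 - ?x) div 2 + ?x"
      by (simp only: div_mult_self1)
    then show ?thesis
      using cc by (auto simp: \<kappa>_def Let_def c'_def u_def map_key_id lookup_add lookup_single when_def
          power_int_add[symmetric] add.commute[of 1] simp del: power_int_add) (auto simp: algebra_simps)
  qed
  show "Tp_gen r n e (r + 1) (D j) = torus_mon (c j) (u j) * dd j" for j
    using n N by (auto simp: Tp_gen_def torus_mon_def c_def u_def mult.assoc)
  show "Tp_gen r n e (r + 1) (X j) = torus_mon (c' j) (neg (u j)) * xx j" for j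
    using n N by (auto simp: Tp_gen_def torus_mon_def c'_def u_def mult.assoc)
  show "Tp_gen r n e (r + 1) (M j) = mm j" "Tp_gen r n e (r + 1) (Minv j) = mi j" for j
    using n N by (simp_all add: Tp_gen_def)
qed simp_all

section \<open>Braid relations\<close>

text \<open>The braid relations hold for arbitrary coefficients depending on the exponents at positions \<open>i\<close> and
\<open>i + 1\<close>. If the first three positions carry \<open>(x, y, z)\<close>, both sides of the relation of length three
collect the factors \<open>F x y\<close>, \<open>F x z\<close>, \<open>F y z\<close>; with a diagonal operator \<open>G\<close> at the end, both sides of
the relation of length four collect \<open>F x y\<close>, \<open>F y x\<close>, \<open>G x z\<close>, \<open>G y z\<close>. Only the order differs.\<close>

definition swap_op :: "(nat \<Rightarrow> nat \<Rightarrow> Qq) \<Rightarrow> nat \<Rightarrow> pols \<Rightarrow> pols" where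
  "swap_op F i = twist (transpose i (i + 1))
    (\<lambda>a. F (Poly_Mapping.lookup a i) (Poly_Mapping.lookup a (i + 1)))"

definition diag_op :: "(nat \<Rightarrow> nat \<Rightarrow> Qq) \<Rightarrow> nat \<Rightarrow> pols \<Rightarrow> pols" where
  "diag_op G i = twist (\<lambda>j. j) (\<lambda>a. G (Poly_Mapping.lookup a i) (Poly_Mapping.lookup a (i + 1)))"

lemma swap_op_mon [simp]:
  "swap_op F i (mon a y) = mon (Poly_Mapping.map_key (transpose i (i + 1)) a)
    (y * F (Poly_Mapping.lookup a i) (Poly_Mapping.lookup a (i + 1)))"
  by (simp add: swap_op_def)

lemma diag_op_mon [simp]:
  "diag_op G i (mon a y) = mon a (y * G (Poly_Mapping.lookup a i) (Poly_Mapping.lookup a (i + 1)))"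
  by (simp add: diag_op_def map_key_id)

lemma swap_op_add: "swap_op F i (f + g) = swap_op F i f + swap_op F i g"
  by (simp add: swap_op_def twist_def lin_ext_add)

lemma diag_op_add: "diag_op G i (f + g) = diag_op G i f + diag_op G i g"
  by (simp add: diag_op_def twist_def lin_ext_add)

lemma mon_eqI:
  assumes "\<And>k. Poly_Mapping.lookup a k = Poly_Mapping.lookup b k" "x = y"
  shows "mon a x = mon b y"
  using assms poly_mapping_eqI[of a b] by simp

lemma swap_op_braid:
  "swap_op F i (swap_op F (Suc i) (swap_op F i f))
    = swap_op F (Suc i) (swap_op F i (swap_op F (Suc i) f))"
proof (rule additive_eq_if_eq_on_singles[of
      "\<lambda>f. swap_op F i (swap_op F (Suc i) (swap_op F i f))"
      "\<lambda>f. swap_op F (Suc i) (swap_op F i (swap_op F (Suc i) f))"])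
  show "swap_op F i (swap_op F (Suc i) (swap_op F i (mon a y)))
    = swap_op F (Suc i) (swap_op F i (swap_op F (Suc i) (mon a y)))" for a y
    unfolding swap_op_mon by (rule mon_eqI) (simp_all add: transpose_def)
qed (simp_all add: swap_op_add)

lemma swap_diag_braid:
  "swap_op F i (diag_op G (Suc i) (swap_op F i (diag_op G (Suc i) f)))
    = diag_op G (Suc i) (swap_op F i (diag_op G (Suc i) (swap_op F i f)))"
proof (rule additive_eq_if_eq_on_singles[of
      "\<lambda>f. swap_op F i (diag_op G (Suc i) (swap_op F i (diag_op G (Suc i) f)))"
      "\<lambda>f. diag_op G (Suc i) (swap_op F i (diag_op G (Suc i) (swap_op F i f)))"])
  show "swap_op F i (diag_op G (Suc i) (swap_op F i (diag_op G (Suc i) (mon a y))))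
    = diag_op G (Suc i) (swap_op F i (diag_op G (Suc i) (swap_op F i (mon a y))))" for a y
    unfolding swap_op_mon diag_op_mon by (rule mon_eqI) (simp_all add: transpose_def)
qed (simp_all add: swap_op_add diag_op_add)

lemma swap_op_commute:
  assumes "i + 1 < j"
  shows "swap_op F i (swap_op F j f) = swap_op F j (swap_op F i f)"
proof (rule additive_eq_if_eq_on_singles[of
      "\<lambda>f. swap_op F i (swap_op F j f)"
      "\<lambda>f. swap_op F j (swap_op F i f)"])
  show "swap_op F i (swap_op F j (mon a y)) = swap_op F j (swap_op F i (mon a y))" for a y
    using assms unfolding swap_op_mon by (intro mon_eqI) (auto simp: transpose_def)
qed (simp_all add: swap_op_add)

lemma swap_diag_commute:
  assumes "i + 1 < j"
  shows "swap_op F i (diag_op G j f) = diag_op G j (swap_op F i f)"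
proof (rule additive_eq_if_eq_on_singles[of
      "\<lambda>f. swap_op F i (diag_op G j f)"
      "\<lambda>f. diag_op G j (swap_op F i f)"])
  show "swap_op F i (diag_op G j (mon a y)) = diag_op G j (swap_op F i (mon a y))" for a y
    using assms unfolding swap_op_mon diag_op_mon by (intro mon_eqI) (auto simp: transpose_def)
qed (simp_all add: swap_op_add diag_op_add)

lemma braid_relations:
  assumes OT: "\<And>i. i < N \<Longrightarrow> OT i = swap_op F i" "OT N = diag_op G N"
  shows "\<lbrakk>2 \<le> i; i < N\<rbrakk> \<Longrightarrow>
      OT (i - 1) (OT i (OT (i - 1) f)) = OT i (OT (i - 1) (OT i f))"
    and "2 \<le> N \<Longrightarrow>
      OT (N - 1) (OT N (OT (N - 1) (OT N f))) = OT N (OT (N - 1) (OT N (OT (N - 1) f)))"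
    and "\<lbrakk>i \<in> {1..N}; j \<in> {1..N}; \<bar>int i - int j\<bar> \<noteq> 1\<rbrakk> \<Longrightarrow> OT i (OT j f) = OT j (OT i f)"
proof -
  show "OT (i - 1) (OT i (OT (i - 1) f)) = OT i (OT (i - 1) (OT i f))" if "2 \<le> i" "i < N"
    using that swap_op_braid[of F "i - 1"] by (simp add: OT)
  show "OT (N - 1) (OT N (OT (N - 1) (OT N f))) = OT N (OT (N - 1) (OT N (OT (N - 1) f)))"
    if "2 \<le> N"
    using that swap_diag_braid[of F "N - 1"] by (simp add: OT)
  have *: "OT i (OT j f) = OT j (OT i f)" if "i + 1 < j" "j \<le> N" for i j
    using that swap_op_commute[of i j] swap_diag_commute[of i j] by (cases "j = N") (simp_all add: OT)
  show "OT i (OT j f) = OT j (OT i f)" if ij: "i \<in> {1..N}" "j \<in> {1..N}" "\<bar>int i - int j\<bar> \<noteq> 1"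
  proof -
    consider "i = j" | "i + 1 < j" | "j + 1 < i" using ij(3) by linarith
    then show ?thesis using *[of i j] *[of j i] ij(1,2) by cases auto
  qed
qed

section \<open>Braid group action on the polynomial representation\<close>

definition OTp_swap_coeff :: "int \<Rightarrow> nat \<Rightarrow> nat \<Rightarrow> Qq" where
  "OTp_swap_coeff e x y = (- (q powi (- e))) powi (- int y) * q powi (e * int x * int y)"

definition OTdp_swap_coeff :: "int \<Rightarrow> nat \<Rightarrow> nat \<Rightarrow> Qq" where
  "OTdp_swap_coeff e x y = (- (q powi (- e))) powi (int x) * q powi (- e * int x * int y)"

text \<open>Here \<open>x\<close> and \<open>y\<close> are the exponents at the positions \<open>N\<close> and \<open>N + 1\<close>, where \<open>N\<close> is the last index.
For even \<open>n\<close> these are the last two variables, since \<open>N = r\<close>; for odd \<open>n\<close> the last variable is the one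
at \<open>N = r + 1\<close>.\<close>

definition OTp_diag_coeff :: "nat \<Rightarrow> nat \<Rightarrow> int \<Rightarrow> nat \<Rightarrow> nat \<Rightarrow> Qq" where
  "OTp_diag_coeff r n e x y = (if n = 2 * r
    then q powi (e * (((int x)\<^sup>2 + 3 * int x) div 2) - e * int y + 2 * e * int x * int y)
    else q powi (e * (((int x)\<^sup>2 - int x) div 2)))"

lemma OTp_eq_swap_op: "i < NN n \<Longrightarrow> OTp r n e i = swap_op (OTp_swap_coeff e) i"
  by (simp add: OTp_def OTp_mon_def[abs_def] swap_op_def twist_def OTp_swap_coeff_def swap_expo_def)

lemma OTdp_eq_swap_op: "i < NN n \<Longrightarrow> OTdp r n e i = swap_op (OTdp_swap_coeff e) i"
  by (simp add: OTdp_def OTdp_mon_def[abs_def] swap_op_def twist_def OTdp_swap_coeff_def swap_expo_def)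

lemma OTp_eq_diag_op:
  "n = 2 * r \<or> n = 2 * r + 1 \<Longrightarrow> OTp r n e (NN n) = diag_op (OTp_diag_coeff r n e) (NN n)"
  by (auto simp: OTp_def OTp_mon_def[abs_def] diag_op_def twist_def OTp_diag_coeff_def map_key_id
      Let_def)

text \<open>At the last index all exponents of \<open>q\<close> and of the torus generators are multiples of \<open>e\<close>, and passing
from one family to the other inverts all these factors.\<close>

lemma Tdp_gen_eq_Tp_gen: "\<not> i < NN n \<Longrightarrow> Tdp_gen r n e i = Tp_gen r n (- e) i"
  by (auto simp: Tdp_gen_def Tp_gen_def fun_eq_iff split: gen.split)

lemma OTdp_eq_OTp: "\<not> i < NN n \<Longrightarrow> OTdp r n e i = OTp r n (- e) i"
  by (simp add: OTdp_def OTp_def OTdp_mon_def[abs_def] OTp_mon_def[abs_def] cong: if_cong)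

lemma OTp_act_diag:
  assumes "r \<ge> 1" "n = 2 * r \<or> n = 2 * r + 1" "A \<in> carrier (Aq r n)"
  shows "OTp r n e (NN n) (act r n A f)
    = act r n (induced r n (Tp_gen r n e (NN n)) A) (OTp r n e (NN n) f)"
  using assms(2)
proof
  assume n: "n = 2 * r"
  show ?thesis
    using weyl_twist_operator.twist_act[OF weyl_twist_operator_diag_even[OF assms(1) n, of e] assms(3), of f]
    using n OTp_eq_diag_op[of n r e] by (simp add: diag_op_def OTp_diag_coeff_def[abs_def] Let_def)
next
  assume n: "n = 2 * r + 1"
  show ?thesis
    using weyl_twist_operator.twist_act[OF weyl_twist_operator_diag_odd[OF n, of e] assms(3), of f]
    using n OTp_eq_diag_op[of n r e] by (simp add: diag_op_def OTp_diag_coeff_def[abs_def] Let_def)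
qed

text \<open>The scalar of the operator matches the one of the general transposition because
\<open>(- q\<^bsup>-e\<^esup>)\<^bsup>-y\<^esup> = \<delta>\<^bsup>-y\<^esup>\<close> for \<open>\<delta> = - q\<^bsup>-e\<^esup>\<close>.\<close>

lemma OTp_act_swap:
  assumes n: "n = 2 * r \<or> n = 2 * r + 1" and i: "1 \<le> i" "i < NN n" and A: "A \<in> carrier (Aq r n)"
  shows "OTp r n e i (act r n A f) = act r n (induced r n (Tp_gen r n e i) A) (OTp r n e i f)"
proof -
  have "i \<in> {1..r}" "cc r n (i + 1) = 1" using n i by (auto simp: cc_def)
  note op = weyl_twist_operator_swap[OF this, where \<gamma> = 1 and \<delta> = "- (q powi (- e))" and \<epsilon> = "- e"
      and \<phi> = "Tp_gen r n e i" and \<kappa> = "\<lambda>a. OTp_swap_coeff e (Poly_Mapping.lookup a i) (Poly_Mapping.lookup a (i + 1))"]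
  show ?thesis
    unfolding OTp_eq_swap_op[OF i(2)] swap_op_def
    by (rule weyl_twist_operator.twist_act[OF op A])
      (use i in \<open>auto simp: Tp_gen_def torus_mon_def scal_uminus OTp_swap_coeff_def power_int_minus mult.assoc
        power_inverse[symmetric] transpose_def\<close>)
qed

text \<open>Here the scalar \<open>(- q\<^bsup>-e\<^esup>)\<^sup>x\<close> is \<open>\<gamma>\<^bsup>-x\<^esup>\<close> for \<open>\<gamma> = - q\<^sup>e\<close>.\<close>

lemma OTdp_act_swap:
  assumes n: "n = 2 * r \<or> n = 2 * r + 1" and i: "1 \<le> i" "i < NN n" and A: "A \<in> carrier (Aq r n)"
  shows "OTdp r n e i (act r n A f) = act r n (induced r n (Tdp_gen r n e i) A) (OTdp r n e i f)"
proof -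
  have "i \<in> {1..r}" "cc r n (i + 1) = 1" using n i by (auto simp: cc_def)
  note op = weyl_twist_operator_swap[OF this, where \<gamma> = "- (q powi e)" and \<delta> = 1 and \<epsilon> = e
      and \<phi> = "Tdp_gen r n e i" and \<kappa> = "\<lambda>a. OTdp_swap_coeff e (Poly_Mapping.lookup a i) (Poly_Mapping.lookup a (i + 1))"]
  show ?thesis
    unfolding OTdp_eq_swap_op[OF i(2)] swap_op_def
    by (rule weyl_twist_operator.twist_act[OF op A])
      (use i in \<open>auto simp: Tdp_gen_def torus_mon_def scal_uminus OTdp_swap_coeff_def power_int_minus mult.assoc
        power_inverse[symmetric] transpose_def\<close>)
qed

theorem theorem4p3:
  fixes r n N :: nat and e :: int
    and T :: "nat \<Rightarrow> falg set \<Rightarrow> falg set"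
    and OT :: "nat \<Rightarrow> pols \<Rightarrow> pols"
  assumes "r \<ge> 1" and "n = 2 * r \<or> n = 2 * r + 1" and "e \<in> {1, -1}"
    and "N = (n + 1) div 2"
    and "(T = Tp r n e \<and> OT = OTp r n e) \<or> (T = Tdp r n e \<and> OT = OTdp r n e)"
  shows "(\<forall>k \<in> carrier (Aq r n). \<forall>f \<in> polys r. \<forall>i \<in> {1..N}.
            OT i (act r n k f) = act r n (T i k) (OT i f))
    \<and> (\<forall>i. 2 \<le> i \<and> i < N \<longrightarrow> (\<forall>f \<in> polys r.
            OT (i - 1) (OT i (OT (i - 1) f)) = OT i (OT (i - 1) (OT i f))))
    \<and> (\<forall>i. 2 \<le> i \<and> i = N \<longrightarrow> (\<forall>f \<in> polys r.
            OT (i - 1) (OT i (OT (i - 1) (OT i f))) = OT i (OT (i - 1) (OT i (OT (i - 1) f)))))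
    \<and> (\<forall>i \<in> {1..N}. \<forall>j \<in> {1..N}. \<bar>int i - int j\<bar> \<noteq> 1 \<longrightarrow>
            (\<forall>f \<in> polys r. OT i (OT j f) = OT j (OT i f)))"
proof -
  have act: "OT i (act r n k f) = act r n (T i k) (OT i f)"
    if k: "k \<in> carrier (Aq r n)" and i: "i \<in> {1..N}" for k f i
  proof (cases "i < N")
    case True
    then show ?thesis
      using assms(2,4,5) k i OTp_act_swap[of n r i k e f] OTdp_act_swap[of n r i k e f]
      by (auto simp: Tp_def Tdp_def)
  next
    case False
    then have "i = NN n" using i assms(4) by simp
    then show ?thesis
      using assms(1,2,5) k OTp_act_diag[of r n k e f] OTp_act_diag[of r n k "- e" f]
      by (auto simp: Tp_def Tdp_def Tdp_gen_eq_Tp_gen OTdp_eq_OTp)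
  qed
  obtain F G where "\<And>i. i < N \<Longrightarrow> OT i = swap_op F i" "OT N = diag_op G N"
  proof (cases "OT = OTp r n e")
    case True
    then show ?thesis using that OTp_eq_swap_op OTp_eq_diag_op assms(2,4) by blast
  next
    case False
    then have "OT = OTdp r n e" using assms(5) by blast
    then show ?thesis
      using that[of "OTdp_swap_coeff e" "OTp_diag_coeff r n (- e)"] assms(2,4) OTdp_eq_swap_op
        OTp_eq_diag_op OTdp_eq_OTp[of "NN n" n] by simp
  qed
  note braid = braid_relations[OF this]
  show ?thesis using act braid by blast
qed

end
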